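(* Let $L$ be a Lagrangian submanifold of a nearly Kähler manifold $(M^{2n},J,g)$, let $H_L$ be its mean curvature vector field and $\mu(L)$ its Maslov 1-form. Then $$-2\,L_\omega(H_L)=\mu(L),$$ i.e. $\mu(L)$ is symplectically dual to minus twice the mean curvature of $L$.
   Context: An almost Hermitian manifold $(M^{2n},J,g)$ is nearly Kähler if $(\nabla^{LC}_XJ)X=0$ for all $X\in TM$ ($\nabla^{LC}$ the Levi-Civita connection). Its fundamental 2-form is $\omega(X,Y):=g(JX,Y)$; a submanifold $L^n\subset M^{2n}$ is Lagrangian if $\omega|_L=0$. Set $L_\omega(V):=V\rfloor\omega$; for a normal vector field $V$ along $L$, $L_\omega(V)$ is regarded as a 1-form on $L$. The mean curvature vector $H_L$ is the trace of the second fundamental form of $L$ (unnormalized). Maslov 1-form: let $U(M)$ be the principal bundle of unitary frames $(e_1,Je_1,\dots,e_n,Je_n)$, and let $(\alpha^i_j)$ be the ($\mathfrak u(n)$-valued) connection 1-form on $U(M)$ of the canonical Hermitian connection $\nabla^{can}$, i.e. the unique unitary connection whose torsion satisfies $T(JX,Y)=T(X,JY)$. With $\theta^i=e_i^*+\sqrt{-1}(Je_i)^*$ the canonical $\mathbb C^n$-valued 1-form, the sign convention is $d\theta^i=-\alpha^i_j\wedge\theta^j+(\text{torsion terms})$, so $\nabla^{can}e_j=\sum_i\alpha^i_j e_i$ with $\sqrt{-1}$ acting as $J$. Put $\gamma:=-\sqrt{-1}\sum_i\alpha^i_i$. Let $Lag(M)$ be the bundle of Lagrangian subspaces of tangent spaces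 of $M$ and $p:U(M)\to Lag(M)$ the projection $(v_1,Jv_1,\dots,v_n,Jv_n)\mapsto[v_1\wedge\dots\wedge v_n]$. There is a 1-form $\bar\gamma$ on $Lag(M)$ with $p^*\bar\gamma=\gamma$. With $g_L:L\to Lag(M)$, $x\mapsto T_xL$, the Gauss map, the Maslov 1-form of $L$ is $\mu(L):=g_L^*(2\bar\gamma)$. *)

theory Defs
  imports "HOL-Analysis.Analysis"
begin

section \<open>Smooth maps and smooth manifolds\<close>

text \<open>\<open>Ck_on k S f\<close> is meant for open \<open>S\<close> in a finite-dimensional space, where continuity of all
  iterated directional derivatives up to order \<open>k\<close> is the usual notion of class \<open>C^k\<close>.\<close>

primrec Ck_on :: "nat \<Rightarrow> 'a::real_normed_vector set \<Rightarrow> ('a \<Rightarrow> 'b::real_normed_vector) \<Rightarrow> bool" where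
  "Ck_on 0 S f \<longleftrightarrow> continuous_on S f"
| "Ck_on (Suc k) S f \<longleftrightarrow> (\<forall>x\<in>S. f differentiable at x) \<and>
     (\<forall>v. Ck_on k S (\<lambda>x. frechet_derivative f (at x) v))"

definition smooth_on :: "'a::real_normed_vector set \<Rightarrow> ('a \<Rightarrow> 'b::real_normed_vector) \<Rightarrow> bool" where
  "smooth_on S f \<longleftrightarrow> (\<forall>k. Ck_on k S f)"

text \<open>A chart is a pair of a domain and a coordinate map (of which only the values on the domain
  matter).\<close>

type_synonym ('m, 'a) chart = "'m set \<times> ('m \<Rightarrow> 'a)"

definition chart_image :: "('m, 'a) chart \<Rightarrow> 'a set" where
  "chart_image c = snd c ` fst c"

definition chart_inv :: "('m, 'a) chart \<Rightarrow> 'a \<Rightarrow> 'm" where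
  "chart_inv c = inv_into (fst c) (snd c)"

text \<open>The identity (or an inclusion) of the underlying point sets, written in the coordinates \<open>c\<close>
  and \<open>d\<close>. The two model spaces may differ, so this is also used for submanifolds.\<close>

definition chart_change :: "('m, 'a) chart \<Rightarrow> ('m, 'b) chart \<Rightarrow> 'a \<Rightarrow> 'b" where
  "chart_change c d x = snd d (chart_inv c x)"

definition overlap :: "('m, 'a) chart \<Rightarrow> ('m, 'b) chart \<Rightarrow> 'a set" where
  "overlap c d = snd c ` (fst c \<inter> fst d)"

text \<open>\<open>A\<close> is a smooth atlas, not necessarily maximal.\<close>

definition smooth_manifold ::
    "'m topology \<Rightarrow> ('m, 'a::euclidean_space) chart set \<Rightarrow> bool" where
  "smooth_manifold X A \<longleftrightarrow>
     Hausdorff_space X \<and> second_countable X \<and>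
     (\<Union>c\<in>A. fst c) = topspace X \<and>
     (\<forall>c\<in>A. openin X (fst c) \<and> open (chart_image c) \<and>
        homeomorphic_map (subtopology X (fst c)) (top_of_set (chart_image c)) (snd c)) \<and>
     (\<forall>c\<in>A. \<forall>d\<in>A. smooth_on (overlap c d) (chart_change c d))"

text \<open>\<open>(Y, B)\<close> is a submanifold of \<open>(X, A)\<close>: the points of \<open>Y\<close> are points of \<open>X\<close> and the inclusion is
  a smooth immersion. Embedded submanifolds are those for which \<open>Y\<close> has the subspace topology.\<close>

definition submanifold ::
    "'m topology \<Rightarrow> ('m, 'b::euclidean_space) chart set \<Rightarrow>
     'm topology \<Rightarrow> ('m, 'a::euclidean_space) chart set \<Rightarrow> bool" where
  "submanifold Y B X A \<longleftrightarrow>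
     smooth_manifold Y B \<and> smooth_manifold X A \<and>
     topspace Y \<subseteq> topspace X \<and> continuous_map Y X id \<and>
     (\<forall>d\<in>B. \<forall>c\<in>A. smooth_on (overlap d c) (chart_change d c) \<and>
        (\<forall>y\<in>overlap d c. inj (frechet_derivative (chart_change d c) (at y))))"


section \<open>Tensor fields and connections in coordinates\<close>

text \<open>Tangent vectors are handled through their coordinates in a chart. A tensor field is a family
  of smooth component functions, one on the image of each chart of the atlas, obeying the
  transformation law of its type.\<close>

type_synonym ('m, 'a) metric = "('m, 'a) chart \<Rightarrow> 'a \<Rightarrow> 'a \<Rightarrow>\<^sub>L 'a \<Rightarrow>\<^sub>L real"
type_synonym ('m, 'a) endo = "('m, 'a) chart \<Rightarrow> 'a \<Rightarrow> 'a \<Rightarrow>\<^sub>L 'a"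
type_synonym ('m, 'a) christoffel = "('m, 'a) chart \<Rightarrow> 'a \<Rightarrow> 'a \<Rightarrow>\<^sub>L 'a \<Rightarrow>\<^sub>L 'a"

definition riemannian_metric ::
    "('m, 'a::euclidean_space) chart set \<Rightarrow> ('m, 'a) metric \<Rightarrow> bool" where
  "riemannian_metric A g \<longleftrightarrow>
     (\<forall>c\<in>A. smooth_on (chart_image c) (g c)) \<and>
     (\<forall>c\<in>A. \<forall>d\<in>A. \<forall>x\<in>overlap c d. \<forall>v w.
        g c x v w = g d (chart_change c d x)
          (frechet_derivative (chart_change c d) (at x) v)
          (frechet_derivative (chart_change c d) (at x) w)) \<and>
     (\<forall>c\<in>A. \<forall>x\<in>chart_image c. \<forall>v w. g c x v w = g c x w v) \<and>
     (\<forall>c\<in>A. \<forall>x\<in>chart_image c. \<forall>v. v \<noteq> 0 \<longrightarrow> g c x v v > 0)"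

definition almost_complex_structure ::
    "('m, 'a::euclidean_space) chart set \<Rightarrow> ('m, 'a) endo \<Rightarrow> bool" where
  "almost_complex_structure A J \<longleftrightarrow>
     (\<forall>c\<in>A. smooth_on (chart_image c) (J c)) \<and>
     (\<forall>c\<in>A. \<forall>d\<in>A. \<forall>x\<in>overlap c d. \<forall>v.
        frechet_derivative (chart_change c d) (at x) (J c x v) =
        J d (chart_change c d x) (frechet_derivative (chart_change c d) (at x) v)) \<and>
     (\<forall>c\<in>A. \<forall>x\<in>chart_image c. \<forall>v. J c x (J c x v) = - v)"

definition almost_hermitian ::
    "('m, 'a::euclidean_space) chart set \<Rightarrow> ('m, 'a) endo \<Rightarrow> ('m, 'a) metric \<Rightarrow> bool" where
  "almost_hermitian A J g \<longleftrightarrow>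
     riemannian_metric A g \<and> almost_complex_structure A J \<and>
     (\<forall>c\<in>A. \<forall>x\<in>chart_image c. \<forall>v w. g c x (J c x v) (J c x w) = g c x v w)"

definition fundamental_form ::
    "('m, 'a::euclidean_space) endo \<Rightarrow> ('m, 'a) metric \<Rightarrow> ('m, 'a) chart \<Rightarrow> 'a \<Rightarrow> 'a \<Rightarrow> 'a \<Rightarrow> real" where
  "fundamental_form J g c x v w = g c x (J c x v) w"

text \<open>An affine connection is given by its Christoffel symbols: in the chart \<open>c\<close>,
  \<open>\<nabla>\<^sub>v W = DW v + \<Gamma>\<^sub>c(v, W)\<close>. The inhomogeneous transformation law below says exactly that
  this expression transforms as a tangent vector.\<close>

definition connection ::
    "('m, 'a::euclidean_space) chart set \<Rightarrow> ('m, 'a) christoffel \<Rightarrow> bool" where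
  "connection A \<Gamma> \<longleftrightarrow>
     (\<forall>c\<in>A. smooth_on (chart_image c) (\<Gamma> c)) \<and>
     (\<forall>c\<in>A. \<forall>d\<in>A. \<forall>x\<in>overlap c d. \<forall>v w.
        frechet_derivative (chart_change c d) (at x) (\<Gamma> c x v w) =
        frechet_derivative (\<lambda>z. frechet_derivative (chart_change c d) (at z) w) (at x) v +
        \<Gamma> d (chart_change c d x)
          (frechet_derivative (chart_change c d) (at x) v)
          (frechet_derivative (chart_change c d) (at x) w))"

text \<open>In the following, vector fields are local ones, defined on the image of a chart.\<close>

definition cov ::
    "('m, 'a::euclidean_space) christoffel \<Rightarrow> ('m, 'a) chart \<Rightarrow> ('a \<Rightarrow> 'a) \<Rightarrow> ('a \<Rightarrow> 'a) \<Rightarrow> 'a \<Rightarrow> 'a" where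
  "cov \<Gamma> c X Y x = frechet_derivative Y (at x) (X x) + \<Gamma> c x (X x) (Y x)"

definition lie_bracket :: "('a::euclidean_space \<Rightarrow> 'a) \<Rightarrow> ('a \<Rightarrow> 'a) \<Rightarrow> 'a \<Rightarrow> 'a" where
  "lie_bracket X Y x = frechet_derivative Y (at x) (X x) - frechet_derivative X (at x) (Y x)"

definition torsion ::
    "('m, 'a::euclidean_space) christoffel \<Rightarrow> ('m, 'a) chart \<Rightarrow> ('a \<Rightarrow> 'a) \<Rightarrow> ('a \<Rightarrow> 'a) \<Rightarrow> 'a \<Rightarrow> 'a" where
  "torsion \<Gamma> c X Y x = cov \<Gamma> c X Y x - cov \<Gamma> c Y X x - lie_bracket X Y x"

definition endo_field ::
    "('m, 'a::euclidean_space) endo \<Rightarrow> ('m, 'a) chart \<Rightarrow> ('a \<Rightarrow> 'a) \<Rightarrow> 'a \<Rightarrow> 'a" where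
  "endo_field J c X x = J c x (X x)"

definition cov_endo ::
    "('m, 'a::euclidean_space) christoffel \<Rightarrow> ('m, 'a) endo \<Rightarrow> ('m, 'a) chart \<Rightarrow>
     ('a \<Rightarrow> 'a) \<Rightarrow> ('a \<Rightarrow> 'a) \<Rightarrow> 'a \<Rightarrow> 'a" where
  "cov_endo \<Gamma> J c X Y x = cov \<Gamma> c X (endo_field J c Y) x - J c x (cov \<Gamma> c X Y x)"

definition metric_connection ::
    "('m, 'a::euclidean_space) chart set \<Rightarrow> ('m, 'a) metric \<Rightarrow> ('m, 'a) christoffel \<Rightarrow> bool" where
  "metric_connection A g \<Gamma> \<longleftrightarrow> connection A \<Gamma> \<and>
     (\<forall>c\<in>A. \<forall>X Y Z. smooth_on (chart_image c) X \<longrightarrow> smooth_on (chart_image c) Y \<longrightarrow>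
        smooth_on (chart_image c) Z \<longrightarrow>
        (\<forall>x\<in>chart_image c.
           frechet_derivative (\<lambda>z. g c z (Y z) (Z z)) (at x) (X x) =
           g c x (cov \<Gamma> c X Y x) (Z x) + g c x (Y x) (cov \<Gamma> c X Z x)))"

definition levi_civita ::
    "('m, 'a::euclidean_space) chart set \<Rightarrow> ('m, 'a) metric \<Rightarrow> ('m, 'a) christoffel \<Rightarrow> bool" where
  "levi_civita A g \<Gamma> \<longleftrightarrow> metric_connection A g \<Gamma> \<and>
     (\<forall>c\<in>A. \<forall>X Y. smooth_on (chart_image c) X \<longrightarrow> smooth_on (chart_image c) Y \<longrightarrow>
        (\<forall>x\<in>chart_image c. torsion \<Gamma> c X Y x = 0))"

definition unitary_connection ::
    "('m, 'a::euclidean_space) chart set \<Rightarrow> ('m, 'a) endo \<Rightarrow> ('m, 'a) metric \<Rightarrow>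
     ('m, 'a) christoffel \<Rightarrow> bool" where
  "unitary_connection A J g \<Gamma> \<longleftrightarrow> metric_connection A g \<Gamma> \<and>
     (\<forall>c\<in>A. \<forall>X Y. smooth_on (chart_image c) X \<longrightarrow> smooth_on (chart_image c) Y \<longrightarrow>
        (\<forall>x\<in>chart_image c. cov_endo \<Gamma> J c X Y x = 0))"

definition canonical_connection ::
    "('m, 'a::euclidean_space) chart set \<Rightarrow> ('m, 'a) endo \<Rightarrow> ('m, 'a) metric \<Rightarrow>
     ('m, 'a) christoffel \<Rightarrow> bool" where
  "canonical_connection A J g \<Gamma> \<longleftrightarrow> unitary_connection A J g \<Gamma> \<and>
     (\<forall>c\<in>A. \<forall>X Y. smooth_on (chart_image c) X \<longrightarrow> smooth_on (chart_image c) Y \<longrightarrow>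
        (\<forall>x\<in>chart_image c.
           torsion \<Gamma> c (endo_field J c X) Y x = torsion \<Gamma> c X (endo_field J c Y) x))"

text \<open>The argument \<open>LC\<close> is the Levi-Civita connection of \<open>g\<close>.\<close>

definition nearly_kaehler ::
    "('m, 'a::euclidean_space) chart set \<Rightarrow> ('m, 'a) endo \<Rightarrow> ('m, 'a) metric \<Rightarrow>
     ('m, 'a) christoffel \<Rightarrow> bool" where
  "nearly_kaehler A J g LC \<longleftrightarrow> almost_hermitian A J g \<and> levi_civita A g LC \<and>
     (\<forall>c\<in>A. \<forall>X. smooth_on (chart_image c) X \<longrightarrow>
        (\<forall>x\<in>chart_image c. cov_endo LC J c X X x = 0))"


section \<open>Mean curvature\<close>

definition orth_proj :: "('a::euclidean_space \<Rightarrow>\<^sub>L 'a \<Rightarrow>\<^sub>L real) \<Rightarrow> 'a set \<Rightarrow> 'a \<Rightarrow>\<^sub>L 'a" where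
  "orth_proj b W = (THE P :: 'a \<Rightarrow>\<^sub>L 'a. \<forall>v. P v \<in> W \<and> (\<forall>w\<in>W. b (v - P v) w = 0))"

text \<open>For a submanifold with chart \<open>d\<close> in a manifold with chart \<open>c\<close>, the inclusion in coordinates
  is \<open>f = chart_change d c\<close>, and the tangent space at \<open>y\<close> is the range of its derivative.\<close>

definition tangent_map ::
    "('m, 'b::euclidean_space) chart \<Rightarrow> ('m, 'a::euclidean_space) chart \<Rightarrow> 'b \<Rightarrow> 'b \<Rightarrow> 'a" where
  "tangent_map d c y = frechet_derivative (chart_change d c) (at y)"

definition tangent_space ::
    "('m, 'b::euclidean_space) chart \<Rightarrow> ('m, 'a::euclidean_space) chart \<Rightarrow> 'b \<Rightarrow> 'a set" where
  "tangent_space d c y = range (tangent_map d c y)"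

text \<open>Covariant derivative, in direction \<open>v\<close>, of a vector field \<open>V\<close> along the submanifold.\<close>

definition cov_along ::
    "('m, 'a::euclidean_space) christoffel \<Rightarrow> ('m, 'b::euclidean_space) chart \<Rightarrow> ('m, 'a) chart \<Rightarrow>
     ('b \<Rightarrow> 'a) \<Rightarrow> 'b \<Rightarrow> 'b \<Rightarrow> 'a" where
  "cov_along \<Gamma> d c V y v =
     frechet_derivative V (at y) v + \<Gamma> c (chart_change d c y) (tangent_map d c y v) (V y)"

text \<open>\<open>(\<nabla>\<^sub>v W)\<^sup>\<bottom>\<close>, where \<open>w\<close> is extended to the tangent vector field \<open>W\<close> with constant coordinates
  in \<open>d\<close>.\<close>

definition second_fundamental_form ::
    "('m, 'a::euclidean_space) metric \<Rightarrow> ('m, 'a) christoffel \<Rightarrow> ('m, 'b::euclidean_space) chart \<Rightarrow>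
     ('m, 'a) chart \<Rightarrow> 'b \<Rightarrow> 'b \<Rightarrow> 'b \<Rightarrow> 'a" where
  "second_fundamental_form g LC d c y v w =
     (let Z = cov_along LC d c (\<lambda>z. tangent_map d c z w) y v
      in Z - orth_proj (g c (chart_change d c y)) (tangent_space d c y) Z)"

definition induced_metric ::
    "('m, 'a::euclidean_space) metric \<Rightarrow> ('m, real^'n) chart \<Rightarrow> ('m, 'a) chart \<Rightarrow>
     real^'n \<Rightarrow> real^'n^'n" where
  "induced_metric g d c y =
     (\<chi> i j. g c (chart_change d c y) (tangent_map d c y (axis i 1)) (tangent_map d c y (axis j 1)))"

text \<open>The unnormalized trace with respect to the induced metric, \<open>h\<^sup>i\<^sup>j II(\<partial>\<^sub>i, \<partial>\<^sub>j)\<close>.\<close>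

definition mean_curvature ::
    "('m, 'a::euclidean_space) metric \<Rightarrow> ('m, 'a) christoffel \<Rightarrow> ('m, real^'n) chart \<Rightarrow>
     ('m, 'a) chart \<Rightarrow> real^'n \<Rightarrow> 'a" where
  "mean_curvature g LC d c y =
     (\<Sum>i\<in>UNIV. \<Sum>j\<in>UNIV. matrix_inv (induced_metric g d c y) $ i $ j *\<^sub>R
        second_fundamental_form g LC d c y (axis i 1) (axis j 1))"

definition lagrangian ::
    "('m, real^'n) chart set \<Rightarrow> ('m, 'a::euclidean_space) chart set \<Rightarrow>
     ('m, 'a) endo \<Rightarrow> ('m, 'a) metric \<Rightarrow> bool" where
  "lagrangian B A J g \<longleftrightarrow> DIM('a) = 2 * CARD('n) \<and>
     (\<forall>d\<in>B. \<forall>c\<in>A. \<forall>y\<in>overlap d c. \<forall>v w.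
        fundamental_form J g c (chart_change d c y) (tangent_map d c y v) (tangent_map d c y w) = 0)"

text \<open>The 1-form \<open>V \<rfloor> \<omega>\<close>, pulled back to the submanifold.\<close>

definition L_omega ::
    "('m, 'a::euclidean_space) endo \<Rightarrow> ('m, 'a) metric \<Rightarrow> ('m, 'b::euclidean_space) chart \<Rightarrow>
     ('m, 'a) chart \<Rightarrow> ('b \<Rightarrow> 'a) \<Rightarrow> 'b \<Rightarrow> 'b \<Rightarrow> real" where
  "L_omega J g d c V y w = fundamental_form J g c (chart_change d c y) (V y) (tangent_map d c y w)"


section \<open>Unitary frames, the Lagrangian Grassmannian bundle and the Maslov form\<close>

text \<open>The part of \<open>U(M)\<close> over the chart \<open>c\<close>, as a subset of the vector space \<open>'a \<times> ('a^'n)\<close>: the frame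
  \<open>(e\<^sub>1, Je\<^sub>1, \<dots>, e\<^sub>n, Je\<^sub>n)\<close> at \<open>x\<close> is recorded as \<open>(x, e)\<close>.\<close>

definition unitary_frames ::
    "('m, 'a::euclidean_space) endo \<Rightarrow> ('m, 'a) metric \<Rightarrow> ('m, 'a) chart \<Rightarrow> ('a \<times> ('a^'n)) set" where
  "unitary_frames J g c = {(x, e). x \<in> chart_image c \<and>
     (\<forall>i j. g c x (e $ i) (e $ j) = (if i = j then 1 else 0) \<and>
            g c x (e $ i) (J c x (e $ j)) = 0)}"

text \<open>The connection form at the frame \<open>u = (x, e)\<close> on a tangent vector \<open>u' = (x', e')\<close>. A curve of
  frames with velocity \<open>u'\<close> has covariant derivatives \<open>\<nabla>e\<^sub>j = e'\<^sub>j + \<Gamma>(x', e\<^sub>j)\<close>, and \<open>\<alpha>\<close> is determined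
  by \<open>\<nabla>e\<^sub>j = \<Sum>\<^sub>i \<alpha>\<^sup>i\<^sub>j e\<^sub>i\<close>, where \<open>\<i>\<close> acts as \<open>J\<close>.\<close>

definition connection_form ::
    "('m, 'a::euclidean_space) endo \<Rightarrow> ('m, 'a) christoffel \<Rightarrow> ('m, 'a) chart \<Rightarrow>
     'a \<times> ('a^'n) \<Rightarrow> 'a \<times> ('a^'n) \<Rightarrow> complex^'n^'n" where
  "connection_form J \<Gamma> c u u' = (THE \<alpha>. \<forall>j.
     snd u' $ j + \<Gamma> c (fst u) (fst u') (snd u $ j) =
     (\<Sum>i\<in>UNIV. Re (\<alpha> $ i $ j) *\<^sub>R (snd u $ i) + Im (\<alpha> $ i $ j) *\<^sub>R J c (fst u) (snd u $ i)))"

definition gamma_form ::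
    "('m, 'a::euclidean_space) endo \<Rightarrow> ('m, 'a) christoffel \<Rightarrow> ('m, 'a) chart \<Rightarrow>
     'a \<times> ('a^'n) \<Rightarrow> 'a \<times> ('a^'n) \<Rightarrow> complex" where
  "gamma_form J \<Gamma> c u u' = - \<i> * trace (connection_form J \<Gamma> c u u')"

text \<open>The part of \<open>Lag(M)\<close> over the chart \<open>c\<close>; a point is a pair of a base point and a Lagrangian
  subspace.\<close>

definition lag_bundle ::
    "('m, 'a::euclidean_space) endo \<Rightarrow> ('m, 'a) metric \<Rightarrow> ('m, 'a) chart \<Rightarrow> ('a \<times> 'a set) set" where
  "lag_bundle J g c = {(x, W). x \<in> chart_image c \<and> subspace W \<and> 2 * dim W = DIM('a) \<and>
     (\<forall>v\<in>W. \<forall>w\<in>W. fundamental_form J g c x v w = 0)}"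

text \<open>The smooth structure of \<open>Lag(M)\<close> over \<open>c\<close>: a subspace is identified with the \<open>g\<close>-orthogonal
  projection onto it, which embeds the bundle as a closed submanifold of
  \<open>chart_image c \<times> End('a)\<close>. Tangent vectors are velocities in the latter space.\<close>

definition lag_embed ::
    "('m, 'a::euclidean_space) metric \<Rightarrow> ('m, 'a) chart \<Rightarrow> 'a \<times> 'a set \<Rightarrow> 'a \<times> ('a \<Rightarrow>\<^sub>L 'a)" where
  "lag_embed g c q = (fst q, orth_proj (g c (fst q)) (snd q))"

definition lag_change ::
    "('m, 'a::euclidean_space) chart \<Rightarrow> ('m, 'a) chart \<Rightarrow> 'a \<times> 'a set \<Rightarrow> 'a \<times> 'a set" where
  "lag_change c d q =
     (chart_change c d (fst q), frechet_derivative (chart_change c d) (at (fst q)) ` snd q)"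

text \<open>The value of a form \<open>\<beta>\<close> on the velocity at time 0 of the image of the curve \<open>u\<close> under \<open>F\<close>.\<close>

definition eval_on_curve ::
    "('e::real_normed_vector \<Rightarrow> 'e \<Rightarrow>\<^sub>L real) \<Rightarrow> ('u \<Rightarrow> 'e) \<Rightarrow> (real \<Rightarrow> 'u) \<Rightarrow> real" where
  "eval_on_curve \<beta> F u = \<beta> (F (u 0)) (vector_derivative (\<lambda>t. F (u t)) (at 0))"

text \<open>A 1-form on \<open>Lag(M)\<close>: over every chart the restriction of a smooth 1-form on the surrounding
  space (restrictions account for all smooth forms, the submanifold being closed), such that these
  restrictions agree over overlaps. Curves that are merely differentiable at 0 are used to produce
  tangent vectors; in a submanifold they have the same velocities as smooth ones.\<close>

type_synonym ('m, 'a) lag_form =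
  "('m, 'a) chart \<Rightarrow> 'a \<times> ('a \<Rightarrow>\<^sub>L 'a) \<Rightarrow> ('a \<times> ('a \<Rightarrow>\<^sub>L 'a)) \<Rightarrow>\<^sub>L real"

definition lag_one_form ::
    "('m, 'a::euclidean_space) chart set \<Rightarrow> ('m, 'a) endo \<Rightarrow> ('m, 'a) metric \<Rightarrow>
     ('m, 'a) lag_form \<Rightarrow> bool" where
  "lag_one_form A J g \<beta> \<longleftrightarrow>
     (\<forall>c\<in>A. smooth_on (chart_image c \<times> UNIV) (\<beta> c)) \<and>
     (\<forall>c\<in>A. \<forall>d\<in>A. \<forall>q.
        (\<forall>\<^sub>F t in nhds 0. q t \<in> lag_bundle J g c \<and> fst (q t) \<in> overlap c d) \<longrightarrow>
        (\<lambda>t. lag_embed g c (q t)) differentiable at (0::real) \<longrightarrow>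
        eval_on_curve (\<beta> c) (lag_embed g c) q =
        eval_on_curve (\<beta> d) (lag_embed g d) (\<lambda>t. lag_change c d (q t)))"

definition frame_proj :: "'a::euclidean_space \<times> ('a^'n) \<Rightarrow> 'a \<times> 'a set" where
  "frame_proj u = (fst u, span (range (\<lambda>i. snd u $ i)))"

text \<open>\<open>p\<^sup>*\<beta> = \<gamma>\<close> on \<open>U(M)\<close>, tested on all tangent vectors of \<open>U(M)\<close>. The first argument only fixes the
  index type \<open>'n\<close> of the frames.\<close>

definition pulls_back_to_gamma ::
    "'n::finite itself \<Rightarrow> ('m, 'a::euclidean_space) chart set \<Rightarrow> ('m, 'a) endo \<Rightarrow> ('m, 'a) metric \<Rightarrow>
     ('m, 'a) christoffel \<Rightarrow> ('m, 'a) lag_form \<Rightarrow> bool" where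
  "pulls_back_to_gamma _ A J g \<Gamma> \<beta> \<longleftrightarrow>
     (\<forall>c\<in>A. \<forall>u :: real \<Rightarrow> 'a \<times> ('a^'n).
        (\<forall>\<^sub>F t in nhds 0. u t \<in> unitary_frames J g c) \<longrightarrow> u differentiable at 0 \<longrightarrow>
        complex_of_real (eval_on_curve (\<beta> c) (\<lambda>v. lag_embed g c (frame_proj v)) u) =
        gamma_form J \<Gamma> c (u 0) (vector_derivative u (at 0)))"

definition gauss_map ::
    "('m, 'b::euclidean_space) chart \<Rightarrow> ('m, 'a::euclidean_space) chart \<Rightarrow> 'b \<Rightarrow> 'a \<times> 'a set" where
  "gauss_map d c y = (chart_change d c y, tangent_space d c y)"

text \<open>The pullback of \<open>2\<beta>\<close> under the Gauss map.\<close>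

definition maslov_form ::
    "('m, 'a::euclidean_space) metric \<Rightarrow> ('m, 'a) lag_form \<Rightarrow> ('m, 'b::euclidean_space) chart \<Rightarrow>
     ('m, 'a) chart \<Rightarrow> 'b \<Rightarrow> 'b \<Rightarrow> real" where
  "maslov_form g \<beta> d c y w =
     (2 *\<^sub>R \<beta> c (lag_embed g c (gauss_map d c y)))
       (frechet_derivative (\<lambda>z. lag_embed g c (gauss_map d c z)) (at y) w)"

end

theory Submission
  imports Defs
begin

text \<open>The difference \<open>A = \<nabla>\<^sup>c\<^sup>a\<^sup>n - \<nabla>\<^sup>L\<^sup>C\<close> is \<open>-1/2 J (\<nabla>\<^sup>L\<^sup>C J)\<close>, and since \<open>\<nabla>\<^sup>L\<^sup>C J\<close> is skew for \<open>g\<close>, \<open>g (A u v) (J v) = 0\<close>.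
  Hence \<open>\<gamma>(w) = \<Sum>\<^sub>j g (\<nabla>\<^sub>w e\<^sub>j) (J e\<^sub>j)\<close> may be computed along \<open>L\<close> with the Levi-Civita connection, for an
  orthonormal tangent frame \<open>e\<close>, which is a unitary frame over the Gauss map because \<open>L\<close> is Lagrangian.
  Differentiating \<open>g (J e) (w) = 0\<close> along \<open>e\<close> and using \<open>(\<nabla>\<^sub>e J) e = 0\<close> shows that
  \<open>C(a, b, c) = g (\<nabla>\<^sub>a b) (J c)\<close> satisfies \<open>C(e, e, w) = C(e, w, e) = C(w, e, e)\<close>; so \<open>\<gamma>(w)\<close> equals
  \<open>\<Sum>\<^sub>j C(e\<^sub>j, e\<^sub>j, w) = g H (J w) = - \<omega>(H, w)\<close>.\<close>

section \<open>Hermitian linear algebra\<close>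

locale hermitian_form =
  fixes G :: "'a::euclidean_space \<Rightarrow>\<^sub>L 'a \<Rightarrow>\<^sub>L real" and J :: "'a \<Rightarrow>\<^sub>L 'a"
  assumes sym: "G v w = G w v"
    and pos: "v \<noteq> 0 \<Longrightarrow> G v v > 0"
    and J_J [simp]: "J (J v) = - v"
    and J_isometry: "G (J v) (J w) = G v w"
begin

lemma J_skew: "G (J v) w = - G v (J w)"
  using J_isometry[of v "J w"] by (simp add: blinfun.bilinear_simps)

text \<open>\<open>A\<close> models the canonical minus the Levi-Civita Christoffel symbols at a
  point. \<open>skew\<close> expresses that both connections are metric, \<open>torsion\<close> that
  the canonical torsion has the prescribed type while the other one vanishes, and
  \<open>nearly\<close> compares the parallel \<open>J\<close> of the first with the nearly Kaehler
  condition on the second.\<close>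

lemma connection_difference_vanishes:
  fixes A :: "'a \<Rightarrow>\<^sub>L 'a \<Rightarrow>\<^sub>L 'a"
  assumes skew: "\<And>u v w. G (A u v) w = - G v (A u w)"
    and torsion: "\<And>u v. A (J u) v - A v (J u) = A u (J v) - A (J v) u"
    and nearly: "\<And>v. J (A v v) = A v (J v)"
  shows "G (A u v) (J v) = 0"
proof -
  txt \<open>\<open>N\<close> plays the role of \<open>\<nabla>\<^sup>L\<^sup>C J\<close> and \<open>B\<close> is the defect in \<open>A = -1/2 J N\<close>. \<open>S\<close> vanishes because it is
    skew-symmetric, \<open>J\<close>-linear in the second and \<open>J\<close>-antilinear in the first argument.\<close>
  define N where "N u v = J (A u v) - A u (J v)" for u v
  define B where "B u v = A u v + (1/2) *\<^sub>R J (N u v)" for u v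
  define S where "S u v = B (J u) v - J (B u v)" for u v
  have N_anti: "N u v = - N v u" for u v
  proof -
    have "J (A (u + v) (u + v)) = A (u + v) (J (u + v))" by (rule nearly)
    then show ?thesis using nearly[of u] nearly[of v]
      by (simp add: N_def blinfun.bilinear_simps algebra_simps)
  qed
  have N_J2: "N u (J v) = - J (N u v)" for u v
    by (simp add: N_def blinfun.bilinear_simps)
  have N_J1: "N (J u) v = - J (N u v)" for u v
    by (metis N_J2 N_anti blinfun.minus_right)
  have B_J2: "B u (J v) = J (B u v)" for u v
  proof -
    have "(1/2) *\<^sub>R N u v + (1/2) *\<^sub>R N u v = J (A u v) - A u (J v)"
      by (simp flip: N_def scaleR_left.add)
    then show ?thesis
      by (simp add: B_def N_J2 blinfun.bilinear_simps algebra_simps)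
  qed
  have B_torsion: "B (J u) v - B v (J u) = B u (J v) - B (J v) u" for u v
  proof -
    have 1: "N v (J u) = J (N u v)" using N_anti[of v "J u"] N_J1[of u v] by simp
    have 2: "N (J v) u = J (N u v)" using N_anti[of "J v" u] N_J2[of u v] by simp
    show ?thesis
      using torsion[of u v]
      by (simp add: B_def N_J1 N_J2 1 2 blinfun.bilinear_simps algebra_simps)
  qed
  have S_anti: "S u v = - S v u" for u v
    using B_torsion[of u v] by (simp add: S_def B_J2 algebra_simps)
  have S_J2: "S u (J v) = J (S u v)" for u v
    by (simp add: S_def B_J2 blinfun.bilinear_simps)
  have S_J1: "S (J u) v = - J (S u v)" for u v
  proof -
    have "B (- u) v = - B u v" for u v by (simp add: B_def N_def blinfun.bilinear_simps algebra_simps)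
    then show ?thesis by (simp add: S_def blinfun.bilinear_simps)
  qed
  have "S (J u) v = J (S u v)" for u v
    by (metis S_anti S_J2 blinfun.minus_right)
  then have "J (S u v) = 0" for u v
    using S_J1[of u v] by (metis eq_neg_iff_add_eq_0 scaleR_2 scaleR_eq_0_iff zero_neq_numeral)
  then have "S u v = 0" for u v
    by (metis J_J blinfun.zero_right neg_equal_0_iff_equal)
  then have B_J1: "B (J u) v = J (B u v)" for u v
    by (simp add: S_def)
  \<comment> \<open>Skewness of \<open>A u\<close> passes to \<open>B u\<close> because
    \<open>J (N u v)\<close> equals \<open>- A u v - J (A u (J v))\<close>, and each summand pairs
    to zero with \<open>v\<close>.\<close>
  have B_skew: "G (B u v) v = 0" for u v
  proof -
    have "G (A u v) v = 0" using skew[of u v v] sym[of v] by simp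
    moreover have "G (J (J (A u v))) v = - G (A u v) v" by (simp add: blinfun.bilinear_simps)
    moreover have "G (J (A u (J v))) v = 0"
      using skew[of u "J v" "J v"] sym[of "A u (J v)" "J v"] by (simp add: J_skew)
    ultimately show ?thesis by (simp add: B_def N_def blinfun.bilinear_simps)
  qed
  \<comment> \<open>Linearity of \<open>B\<close> over \<open>J\<close> in the first argument turns
    skewness of \<open>B (J u)\<close> into \<open>G (J (B u v)) v = 0\<close>; then
    \<open>J\<close> moves across.\<close>
  have "G (B u v) (J v) = 0"
    using B_skew[of "J u" v] by (simp add: B_J1 J_skew)
  moreover have "G (N u v) v = 0"
    using skew[of u "J v" v] sym[of "A u v" "J v"]
    by (simp add: N_def J_skew blinfun.bilinear_simps)
  ultimately show ?thesis
    by (simp add: B_def J_isometry blinfun.bilinear_simps)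
qed

end

section \<open>Orthonormal families and traces of bilinear forms\<close>

lemma bilinear_sum_left: "bilinear b \<Longrightarrow> b (sum f S) y = (\<Sum>i\<in>S. b (f i) y)"
  using linear_sum[of "\<lambda>x. b x y"] by (simp add: bilinear_def)

lemma bilinear_sum_right: "bilinear b \<Longrightarrow> b x (sum f S) = (\<Sum>i\<in>S. b x (f i))"
  using linear_sum[of "b x"] by (simp add: bilinear_def)

text \<open>Pairing a linear relation with \<open>e j\<close> isolates its coefficient at
  \<open>j\<close>, so the family is independent, and the dimension count makes it spanning.\<close>

lemma orthonormal_expansion:
  fixes e :: "'i::finite \<Rightarrow> 'b::euclidean_space"
  assumes b: "bilinear b" and orth: "\<And>i j. b (e i) (e j) = (if i = j then 1 else (0::real))"
    and dim: "CARD('i) = DIM('b)"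
  shows "v = (\<Sum>i\<in>UNIV. b v (e i) *\<^sub>R e i)"
proof -
  have coeff: "b (\<Sum>i\<in>UNIV. c i *\<^sub>R e i) (e j) = c j" for c j
    by (simp add: bilinear_sum_left[OF b] bilinear_lmul[OF b] orth if_distrib[of "(*) _"] cong: if_cong)
  have "inj e"
    by (metis injI orth zero_neq_one)
  then have card: "card (range e) = DIM('b)"
    by (simp add: card_image dim)
  have "independent (range e)"
  proof (rule independent_if_scalars_zero)
    fix c x assume 0: "(\<Sum>x\<in>range e. c x *\<^sub>R x) = 0" and "x \<in> range e"
    then obtain j where j: "x = e j" by auto
    have "(\<Sum>i\<in>UNIV. c (e i) *\<^sub>R e i) = 0"
      using 0 \<open>inj e\<close> by (simp add: sum.reindex)
    then show "c x = 0"
      using coeff[of "c \<circ> e" j] by (simp add: j bilinear_lzero[OF b])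
  qed simp
  then have "v \<in> span (range e)"
    using card card_ge_dim_independent[of "range e" UNIV] by auto
  then obtain c where "v = (\<Sum>x\<in>range e. c x *\<^sub>R x)"
    using span_finite[of "range e"] by auto
  then have v: "v = (\<Sum>i\<in>UNIV. c (e i) *\<^sub>R e i)"
    using \<open>inj e\<close> by (simp add: sum.reindex)
  then have "b v (e i) = c (e i)" for i
    using coeff[of "c \<circ> e"] by simp
  with v show ?thesis by simp
qed

text \<open>\<open>matrix_inv\<close> chooses some two-sided inverse; for square matrices a
  one-sided inverse is two-sided, and this determines the choice.\<close>

lemma matrix_inv_eqI:
  fixes A B :: "real^'n^'n"
  assumes "B ** A = mat 1"
  shows "matrix_inv A = B"
proof -
  have "A ** B = mat 1" using assms by (simp add: matrix_left_right_inverse)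
  then have "A ** matrix_inv A = mat 1"
    unfolding matrix_inv_def using assms by (rule_tac someI2[of _ B]) auto
  then show ?thesis
    by (metis assms matrix_mul_assoc matrix_mul_lid matrix_mul_rid)
qed

text \<open>With the orthonormal vectors as columns of \<open>P\<close>, the inverse Gram matrix is
  \<open>P ** transpose P\<close>. This converts the coordinate contraction in
  \<open>mean_curvature\<close> into a sum over an orthonormal frame.\<close>

lemma matrix_inv_orthonormal_trace:
  fixes h Q :: "real^'n \<Rightarrow> real^'n \<Rightarrow> real" and p :: "'n \<Rightarrow> real^'n"
  assumes h: "bilinear h" and Q: "bilinear Q"
    and orth: "\<And>i j. h (p i) (p j) = (if i = j then 1 else 0)"
  shows "(\<Sum>i\<in>UNIV. \<Sum>j\<in>UNIV. matrix_inv (\<chi> i j. h (axis i 1) (axis j 1)) $ i $ j * Q (axis i 1) (axis j 1))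
    = (\<Sum>k\<in>UNIV. Q (p k) (p k))"
proof -
  define H :: "real^'n^'n" where "H = (\<chi> i j. h (axis i 1) (axis j 1))"
  define P :: "real^'n^'n" where "P = (\<chi> i k. p k $ i)"
  have expand: "b (p k) (p l) = (\<Sum>i\<in>UNIV. \<Sum>j\<in>UNIV. p k $ i * p l $ j * b (axis i 1) (axis j 1))"
    if b: "bilinear b" for b :: "real^'n \<Rightarrow> real^'n \<Rightarrow> real" and k l
  proof -
    have "b (p k) (p l) = b (\<Sum>i\<in>UNIV. p k $ i *\<^sub>R axis i 1) (\<Sum>j\<in>UNIV. p l $ j *\<^sub>R axis j 1)"
      using basis_expansion[of "p k"] basis_expansion[of "p l"] by (simp add: scalar_mult_eq_scaleR)
    then show ?thesis
      by (simp add: bilinear_sum_left[OF b] bilinear_lmul[OF b] bilinear_sum_right[OF b] bilinear_rmul[OF b]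
          sum_distrib_left mult_ac) (rule sum.swap)
  qed
  have "(transpose P ** H) ** P = mat 1"
  proof -
    have "((transpose P ** H) ** P) $ k $ l = h (p k) (p l)" for k l
      by (simp add: expand[OF h] matrix_matrix_mult_def transpose_def P_def H_def
          sum_distrib_right sum_distrib_left mult_ac, subst sum.swap, simp)
    then show ?thesis by (simp add: vec_eq_iff orth mat_def)
  qed
  \<comment> \<open>The left inverse \<open>transpose P ** H\<close> of \<open>P\<close> is also a
    right inverse; reassociating exhibits a left inverse of \<open>H\<close>.\<close>
  then have "P ** transpose P ** H = mat 1"
    unfolding matrix_left_right_inverse[of "transpose P ** H" P] by (simp add: matrix_mul_assoc)
  then have "matrix_inv H = P ** transpose P"
    by (rule matrix_inv_eqI)
  then have "matrix_inv H $ i $ j = (\<Sum>k\<in>UNIV. p k $ i * p k $ j)" for i j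
    by (simp add: matrix_matrix_mult_def transpose_def P_def)
  moreover have "(\<Sum>i\<in>UNIV. \<Sum>j\<in>UNIV. (\<Sum>k\<in>UNIV. p k $ i * p k $ j) * Q (axis i 1) (axis j 1))
    = (\<Sum>k\<in>UNIV. Q (p k) (p k))" (is "?lhs = _")
  proof -
    have "?lhs = (\<Sum>i\<in>UNIV. \<Sum>j\<in>UNIV. \<Sum>k\<in>UNIV. p k $ i * p k $ j * Q (axis i 1) (axis j 1))"
      by (simp add: sum_distrib_right)
    also have "\<dots> = (\<Sum>i\<in>UNIV. \<Sum>k\<in>UNIV. \<Sum>j\<in>UNIV. p k $ i * p k $ j * Q (axis i 1) (axis j 1))"
      by (intro sum.cong refl sum.swap)
    also have "\<dots> = (\<Sum>k\<in>UNIV. \<Sum>i\<in>UNIV. \<Sum>j\<in>UNIV. p k $ i * p k $ j * Q (axis i 1) (axis j 1))"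
      by (rule sum.swap)
    finally show ?thesis by (simp add: expand[OF Q])
  qed
  ultimately show ?thesis by (simp flip: H_def)
qed

section \<open>Orthogonal projections and unitary frames of a Hermitian form\<close>

context hermitian_form
begin

lemma bilinear_form: "bilinear (\<lambda>v w. G v w)"
  by (auto simp: bilinear_def intro!: linearI simp: blinfun.bilinear_simps)

text \<open>Two candidates for the projection differ by a vector that lies in the span and is
  orthogonal to it, hence is zero. The explicit sum shows how the projection depends on the frame,
  so that it can be differentiated.\<close>

lemma orth_proj_eq_sum:
  fixes e :: "'i::finite \<Rightarrow> 'a"
  assumes orth: "\<And>i j. G (e i) (e j) = (if i = j then 1 else 0)"
  shows "orth_proj G (span (range e)) = (\<Sum>i\<in>UNIV. blinfun_scaleR_left (e i) o\<^sub>L G (e i))"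
    (is "_ = ?P")
  unfolding orth_proj_def
proof (rule the_equality)
  have P: "?P v = (\<Sum>i\<in>UNIV. G v (e i) *\<^sub>R e i)" for v
    by (simp add: blinfun.sum_left sym)
  have in_span: "?P v \<in> span (range e)" for v
    unfolding P by (intro span_sum span_scale span_base) auto
  have orth_e: "G (v - ?P v) (e i) = 0" for v i
    unfolding P by (simp add: blinfun.bilinear_simps blinfun.sum_left blinfun.sum_right orth if_distrib[of "(*) _"] cong: if_cong)
  have orth_span: "G (v - ?P v) w = 0" if "w \<in> span (range e)" for v w
    proof -
    have "subspace {w. G (v - ?P v) w = 0}"
      by (intro subspaceI) (simp_all only: mem_Collect_eq blinfun.zero_right blinfun.add_right blinfun.scaleR_right add_0 scaleR_zero_right)
    then have "span (range e) \<subseteq> {w. G (v - ?P v) w = 0}"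
      using orth_e by (intro span_minimal) blast+
    then show ?thesis using that by blast
  qed
  show "\<forall>v. ?P v \<in> span (range e) \<and> (\<forall>w\<in>span (range e). G (v - ?P v) w = 0)"
    using in_span orth_span by blast
  fix P' :: "'a \<Rightarrow>\<^sub>L 'a"
  assume P': "\<forall>v. P' v \<in> span (range e) \<and> (\<forall>w\<in>span (range e). G (v - P' v) w = 0)"
  show "P' = ?P"
  proof (rule blinfun_eqI)
    fix v
    define a where "a = ?P v"
    have a: "a \<in> span (range e)" "\<And>w. w \<in> span (range e) \<Longrightarrow> G (v - a) w = 0"
      using in_span orth_span by (simp_all only: a_def)
    then have d: "a - P' v \<in> span (range e)"
      using P' by (intro span_diff) auto
    then have "G (v - P' v) (a - P' v) = 0" "G (v - a) (a - P' v) = 0"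
      using P' a(2) by auto
    then have "G (a - P' v) (a - P' v) = 0"
      by (simp add: blinfun.bilinear_simps)
    then have "P' v = a"
      using pos[of "a - P' v"] by force
    then show "P' v = ?P v" by (simp only: a_def)
  qed
qed

text \<open>The condition that \<open>unitary_frames\<close> imposes on a frame over a fixed base
  point.\<close>

definition unitary_at :: "'a^'n \<Rightarrow> bool" where
  "unitary_at e \<longleftrightarrow> (\<forall>i j. G (e $ i) (e $ j) = (if i = j then 1 else 0) \<and> G (e $ i) (J (e $ j)) = 0)"

text \<open>The doubled family of the vectors of \<open>e\<close> and their images under
  \<open>J\<close>, indexed by \<open>'n + 'n\<close>, is orthonormal and has as many members as the
  dimension.\<close>

lemma unitary_expansion:
  fixes e :: "'a^'n"
  assumes e: "unitary_at e" and dim: "DIM('a) = 2 * CARD('n)"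
  shows "v = (\<Sum>i\<in>UNIV. G v (e $ i) *\<^sub>R e $ i + G v (J (e $ i)) *\<^sub>R J (e $ i))"
proof -
  define f :: "'n + 'n \<Rightarrow> 'a" where "f = case_sum (\<lambda>i. e $ i) (\<lambda>i. J (e $ i))"
  have e1: "G (e $ i) (e $ j) = (if i = j then 1 else 0)" and e2: "G (e $ i) (J (e $ j)) = 0" for i j
    using e by (auto simp: unitary_at_def)
  have e3: "G (J (e $ i)) (e $ j) = 0" for i j using e2[of j i] sym by metis
  have "G (f i) (f j) = (if i = j then 1 else 0)" for i j
    by (cases i; cases j) (simp_all add: f_def e1 e2 e3 J_isometry)
  then have "v = (\<Sum>i\<in>UNIV. G v (f i) *\<^sub>R f i)"
    by (rule orthonormal_expansion[OF bilinear_form]) (simp add: dim)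
  also have "\<dots> = (\<Sum>i\<in>UNIV. G v (e $ i) *\<^sub>R e $ i) + (\<Sum>i\<in>UNIV. G v (J (e $ i)) *\<^sub>R J (e $ i))"
    unfolding UNIV_Plus_UNIV[symmetric] by (subst sum.Plus) (simp_all add: f_def)
  finally show ?thesis by (simp add: sum.distrib)
qed

text \<open>This evaluates the description in \<open>connection_form\<close>: pairing with
  \<open>e $ k\<close> and \<open>J (e $ k)\<close> recovers the real and imaginary parts of the
  coefficients, so they are unique.\<close>

lemma unitary_coefficients:
  fixes e :: "'a^'n" and V :: "'n \<Rightarrow> 'a"
  assumes e: "unitary_at e" and dim: "DIM('a) = 2 * CARD('n)"
  shows "(THE \<alpha>. \<forall>j. V j = (\<Sum>i\<in>UNIV. Re (\<alpha> $ i $ j) *\<^sub>R e $ i + Im (\<alpha> $ i $ j) *\<^sub>R J (e $ i)))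
    = (\<chi> i j. Complex (G (V j) (e $ i)) (G (V j) (J (e $ i))))"
proof (rule the_equality)
  show "\<forall>j. V j = (\<Sum>i\<in>UNIV.
      Re ((\<chi> i j. Complex (G (V j) (e $ i)) (G (V j) (J (e $ i)))) $ i $ j) *\<^sub>R e $ i +
      Im ((\<chi> i j. Complex (G (V j) (e $ i)) (G (V j) (J (e $ i)))) $ i $ j) *\<^sub>R J (e $ i))"
    using unitary_expansion[OF e dim] by simp
  fix \<alpha> :: "complex^'n^'n"
  assume \<alpha>: "\<forall>j. V j = (\<Sum>i\<in>UNIV. Re (\<alpha> $ i $ j) *\<^sub>R e $ i + Im (\<alpha> $ i $ j) *\<^sub>R J (e $ i))"
  have e1: "G (e $ i) (e $ j) = (if i = j then 1 else 0)" and e2: "G (e $ i) (J (e $ j)) = 0" for i j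
    using e by (auto simp: unitary_at_def)
  have e3: "G (J (e $ i)) (e $ j) = 0" for i j using e2 sym by simp
  have "G (V j) (e $ k) = Re (\<alpha> $ k $ j)" "G (V j) (J (e $ k)) = Im (\<alpha> $ k $ j)" for j k
    by (simp_all add: spec[OF \<alpha>, of j] blinfun.bilinear_simps blinfun.sum_left e1 e2 e3 J_isometry
        if_distrib[of "(*) _"] cong: if_cong)
  then show "\<alpha> = (\<chi> i j. Complex (G (V j) (e $ i)) (G (V j) (J (e $ i))))"
    by (simp add: vec_eq_iff)
qed

end

section \<open>Orthonormalization and second derivatives\<close>

lemma differentiable_transform_nhds:
  assumes "f differentiable (at x)" and "\<forall>\<^sub>F z in nhds x. f z = g z"
  shows "g differentiable (at x)"
  using assms unfolding differentiable_def eventually_nhds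
  by (meson has_derivative_transform_within_open)

lemma differentiable_vec_nth:
  assumes "f differentiable (at x)"
  shows "(\<lambda>z. f z $ i) differentiable (at x)"
  using assms bounded_linear.has_derivative[OF bounded_linear_vec_nth]
  unfolding differentiable_def by blast

text \<open>Gram-Schmidt applied to the coordinate vectors, for all forms \<open>h z\<close> near
  \<open>y\<close> at once; every operation involved preserves differentiability at
  \<open>y\<close>.\<close>

lemma differentiable_orthonormalization:
  fixes h :: "'z::real_normed_vector \<Rightarrow> real^'n \<Rightarrow> real^'n \<Rightarrow> real"
  assumes h: "\<forall>\<^sub>F z in nhds y. bilinear (h z) \<and> (\<forall>a b. h z a b = h z b a) \<and> (\<forall>a. a \<noteq> 0 \<longrightarrow> h z a a > 0)"
    and diff: "\<And>a b. (\<lambda>z. h z a b) differentiable at y"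
  obtains p :: "'n \<Rightarrow> 'z \<Rightarrow> real^'n" where "\<And>i. p i differentiable at y"
    and "\<forall>\<^sub>F z in nhds y. \<forall>i j. h z (p i z) (p j z) = (if i = j then 1 else 0)"
proof -
  \<comment> \<open>Expanding both arguments along the axes reduces varying arguments to the fixed
    ones of \<open>diff\<close>; bilinearity is available only near \<open>y\<close>.\<close>
  have diff_h: "(\<lambda>z. h z (a z) (b z)) differentiable at y"
    if a: "a differentiable at y" and b: "b differentiable at y" for a b
  proof -
    have "(\<lambda>z. \<Sum>i\<in>UNIV. \<Sum>j\<in>UNIV. a z $ i * (b z $ j * h z (axis i 1) (axis j 1))) differentiable at y"
      using a b diff by (intro differentiable_sum ballI differentiable_mult differentiable_vec_nth) auto
    moreover have "\<forall>\<^sub>F z in nhds y. (\<Sum>i\<in>UNIV. \<Sum>j\<in>UNIV. a z $ i * (b z $ j * h z (axis i 1) (axis j 1)))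
      = h z (a z) (b z)"
      using h
    proof eventually_elim
      case (elim z)
      then have bil: "bilinear (h z)" by simp
      have "h z (a z) (b z) = h z (\<Sum>i\<in>UNIV. a z $ i *\<^sub>R axis i 1) (\<Sum>j\<in>UNIV. b z $ j *\<^sub>R axis j 1)"
        using basis_expansion[of "a z"] basis_expansion[of "b z"] by (simp add: scalar_mult_eq_scaleR)
      then show ?case
        by (simp add: bilinear_sum_left[OF bil] bilinear_lmul[OF bil] bilinear_sum_right[OF bil]
            bilinear_rmul[OF bil] sum_distrib_left mult_ac) (rule sum.swap)
    qed
    ultimately show ?thesis by (rule differentiable_transform_nhds)
  qed
  \<comment> \<open>The vectors built so far have no coordinates outside \<open>S\<close>. Hence
    subtracting their span from \<open>axis k 1\<close> leaves the \<open>k\<close>-th coordinate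
    equal to 1, and the vector to be normalized is nonzero.\<close>
  have "\<exists>p. (\<forall>i\<in>S. p i differentiable at y) \<and>
      (\<forall>\<^sub>F z in nhds y. (\<forall>i\<in>S. \<forall>k. k \<notin> S \<longrightarrow> p i z $ k = 0) \<and>
        (\<forall>i\<in>S. \<forall>j\<in>S. h z (p i z) (p j z) = (if i = j then 1 else 0)))" if "finite S" for S :: "'n set"
    using that
  proof (induction S)
    case (insert k S)
    then obtain p where p: "\<And>i. i \<in> S \<Longrightarrow> p i differentiable at y"
      and ev: "\<forall>\<^sub>F z in nhds y. (\<forall>i\<in>S. \<forall>k. k \<notin> S \<longrightarrow> p i z $ k = 0) \<and>
        (\<forall>i\<in>S. \<forall>j\<in>S. h z (p i z) (p j z) = (if i = j then 1 else 0))" by blast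
    define q where "q z = axis k 1 - (\<Sum>i\<in>S. h z (axis k 1) (p i z) *\<^sub>R p i z)" for z
    define r where "r z = h z (q z) (q z)" for z
    define p' where "p' = p(k := \<lambda>z. inverse (sqrt (r z)) *\<^sub>R q z)"
    have q: "q differentiable at y"
      unfolding q_def using p diff_h by (intro differentiable_diff differentiable_sum ballI differentiable_scaleR insert.hyps) auto
    then have r: "r differentiable at y"
      unfolding r_def by (intro diff_h)
    have r_pos: "\<forall>\<^sub>F z in nhds y. r z > 0"
      using h ev
    proof eventually_elim
      case (elim z)
      then have "q z $ k = 1" using insert.hyps by (simp add: q_def)
      then have "q z \<noteq> 0" by auto
      then show ?case using elim by (simp add: r_def)
    qed
    then have "r y > 0" by (rule eventually_nhds_x_imp_x)
    then have "(\<lambda>z. inverse (sqrt (r z)) *\<^sub>R q z) differentiable at y"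
      using q r by (auto simp: differentiable_def intro!: derivative_eq_intros)
    then have "\<forall>i\<in>insert k S. p' i differentiable at y"
      using p by (auto simp: p'_def)
    moreover have "\<forall>\<^sub>F z in nhds y. (\<forall>i\<in>insert k S. \<forall>l. l \<notin> insert k S \<longrightarrow> p' i z $ l = 0) \<and>
        (\<forall>i\<in>insert k S. \<forall>j\<in>insert k S. h z (p' i z) (p' j z) = (if i = j then 1 else 0))"
      using h ev r_pos
    proof eventually_elim
      case (elim z)
      then have bil: "bilinear (h z)" and sym: "\<And>a b. h z a b = h z b a" by auto
      have q_orth: "h z (q z) (p j z) = 0" if "j \<in> S" for j
      proof -
        have "h z (q z) (p j z) = h z (axis k 1) (p j z)
          - (\<Sum>i\<in>S. h z (axis k 1) (p i z) * h z (p i z) (p j z))"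
          by (simp add: q_def bilinear_lsub[OF bil] bilinear_sum_left[OF bil] bilinear_lmul[OF bil])
        also have "(\<Sum>i\<in>S. h z (axis k 1) (p i z) * h z (p i z) (p j z))
          = (\<Sum>i\<in>S. if i = j then h z (axis k 1) (p i z) else 0)"
          using elim that by (intro sum.cong) auto
        finally show ?thesis using that insert.hyps by simp
      qed
      have "h z (p' k z) (p' k z) = inverse (sqrt (r z)) * (inverse (sqrt (r z)) * r z)"
        by (simp add: p'_def r_def bilinear_lmul[OF bil] bilinear_rmul[OF bil])
      also have "\<dots> = 1"
        using elim by (simp add: field_simps real_sqrt_mult_self)
      finally have 1: "h z (p' k z) (p' k z) = 1" .
      have 2: "h z (p' k z) (p' j z) = 0" "h z (p' j z) (p' k z) = 0" if "j \<in> S" for j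
        using that insert.hyps q_orth[OF that] sym
        by (auto simp: p'_def bilinear_lmul[OF bil] bilinear_rmul[OF bil])
      have 3: "p' i z = p i z" if "i \<in> S" for i
        using that insert.hyps by (auto simp: p'_def)
      have 4: "p' k z $ l = 0" if "l \<notin> insert k S" for l
        using that elim by (auto simp: p'_def q_def axis_def)
      show ?case
        using 1 2 3 4 elim insert.hyps by auto
    qed
    ultimately show ?case by blast
  qed auto
  from this[of UNIV] obtain p :: "'n \<Rightarrow> 'z \<Rightarrow> real^'n" where "\<forall>i. p i differentiable at y"
    and "\<forall>\<^sub>F z in nhds y. \<forall>i j. h z (p i z) (p j z) = (if i = j then 1 else 0)"
    by auto
  then show ?thesis by (intro that[of p]) auto
qed

section \<open>Symmetry of second derivatives\<close>

lemma DERIV_along_line: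
  fixes f :: "'b::real_normed_vector \<Rightarrow> 'a::real_inner"
  assumes "(f has_derivative f') (at (y + s *\<^sub>R v + c))"
  shows "((\<lambda>s. f (y + s *\<^sub>R v + c) \<bullet> a) has_real_derivative f' v \<bullet> a) (at s)"
proof -
  have "((\<lambda>s. y + s *\<^sub>R v + c) has_derivative (\<lambda>t. t *\<^sub>R v)) (at s)"
    by (auto intro!: derivative_eq_intros)
  from diff_chain_at[OF this assms]
  have "((\<lambda>s. f (y + s *\<^sub>R v + c)) has_derivative (\<lambda>t. f' (t *\<^sub>R v))) (at s)"
    by (simp add: o_def)
  then have "((\<lambda>s. f (y + s *\<^sub>R v + c) \<bullet> a) has_derivative (\<lambda>t. f' (t *\<^sub>R v) \<bullet> a)) (at s)"
    by (rule has_derivative_inner_left)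
  moreover have "f' (t *\<^sub>R v) \<bullet> a = f' v \<bullet> a * t" for t
    using has_derivative_linear[OF assms] by (simp add: linear_cmul)
  ultimately show ?thesis by (simp add: has_field_derivative_def)
qed

text \<open>The mean value theorem is used twice: along \<open>v\<close> for the difference of two
  parallel edges of the parallelogram, then along \<open>w\<close> for the derivative in direction
  \<open>v\<close>. Pairing with \<open>a\<close> makes the functions real-valued, as that theorem
  requires.\<close>

lemma second_difference:
  fixes f :: "'b::real_normed_vector \<Rightarrow> 'a::real_inner"
  assumes f: "\<And>z. z \<in> ball y \<epsilon> \<Longrightarrow> f differentiable (at z)"
    and f': "\<And>z. z \<in> ball y \<epsilon> \<Longrightarrow> (\<lambda>z. frechet_derivative f (at z) v) differentiable (at z)"
    and h: "h > 0" "h * (norm v + norm w) < \<epsilon>"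
  obtains z where "z \<in> ball y \<epsilon>"
    and "(f (y + h *\<^sub>R v + h *\<^sub>R w) - f (y + h *\<^sub>R v) - f (y + h *\<^sub>R w) + f y) \<bullet> a
      = h * h * (frechet_derivative (\<lambda>z. frechet_derivative f (at z) v) (at z) w \<bullet> a)"
proof -
  define D where "D z = frechet_derivative f (at z) v" for z
  have inball: "y + s *\<^sub>R v + t *\<^sub>R w \<in> ball y \<epsilon>" if "0 \<le> s" "s \<le> h" "0 \<le> t" "t \<le> h" for s t
  proof -
    have "norm (s *\<^sub>R v + t *\<^sub>R w) \<le> s * norm v + t * norm w"
      using that norm_triangle_ineq[of "s *\<^sub>R v" "t *\<^sub>R w"] by simp
    also have "\<dots> \<le> h * norm v + h * norm w"
      using that by (intro add_mono mult_right_mono) auto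
    also have "\<dots> < \<epsilon>" using h by (simp add: algebra_simps)
    finally have "norm (s *\<^sub>R v + t *\<^sub>R w) < \<epsilon>" .
    moreover have "dist y (y + x) = norm x" for x by (simp add: dist_norm)
    ultimately show ?thesis by (simp only: mem_ball add.assoc)
  qed
  \<comment> \<open>The summand \<open>0 *\<^sub>R w\<close> gives both terms the shape expected by
    \<open>DERIV_along_line\<close> and \<open>inball\<close>.\<close>
  define \<phi> where "\<phi> s = f (y + s *\<^sub>R v + h *\<^sub>R w) \<bullet> a - f (y + s *\<^sub>R v + 0 *\<^sub>R w) \<bullet> a" for s
  have "(\<phi> has_real_derivative D (y + s *\<^sub>R v + h *\<^sub>R w) \<bullet> a - D (y + s *\<^sub>R v + 0 *\<^sub>R w) \<bullet> a) (at s)"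
    if "0 \<le> s" "s \<le> h" for s
    unfolding \<phi>_def D_def using that h
    by (intro DERIV_diff DERIV_along_line frechet_derivative_works[THEN iffD1] f inball) auto
  from MVT2[OF \<open>h > 0\<close> this]
  obtain s where s: "0 < s" "s < h"
    and \<phi>: "\<phi> h - \<phi> 0 = h * (D (y + s *\<^sub>R v + h *\<^sub>R w) \<bullet> a - D (y + s *\<^sub>R v + 0 *\<^sub>R w) \<bullet> a)"
    by auto
  have "((\<lambda>t. D (y + t *\<^sub>R w + s *\<^sub>R v) \<bullet> a) has_real_derivative
      frechet_derivative D (at (y + s *\<^sub>R v + t *\<^sub>R w)) w \<bullet> a) (at t)"
    if "0 \<le> t" "t \<le> h" for t
  proof -
    have "y + t *\<^sub>R w + s *\<^sub>R v = y + s *\<^sub>R v + t *\<^sub>R w" by (simp add: algebra_simps)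
    then have "(D has_derivative frechet_derivative D (at (y + s *\<^sub>R v + t *\<^sub>R w))) (at (y + t *\<^sub>R w + s *\<^sub>R v))"
      unfolding D_def[abs_def] using f'[OF inball, of s t] that s by (simp only: frechet_derivative_works)
    then show ?thesis by (rule DERIV_along_line)
  qed
  from MVT2[OF \<open>h > 0\<close> this]
  obtain t where t: "0 < t" "t < h"
    and D: "D (y + h *\<^sub>R w + s *\<^sub>R v) \<bullet> a - D (y + 0 *\<^sub>R w + s *\<^sub>R v) \<bullet> a
      = h * (frechet_derivative D (at (y + s *\<^sub>R v + t *\<^sub>R w)) w \<bullet> a)"
    by auto
  have "(f (y + h *\<^sub>R v + h *\<^sub>R w) - f (y + h *\<^sub>R v) - f (y + h *\<^sub>R w) + f y) \<bullet> a = \<phi> h - \<phi> 0"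
    by (simp add: \<phi>_def inner_diff_left inner_add_left)
  also have "\<dots> = h * h * (frechet_derivative D (at (y + s *\<^sub>R v + t *\<^sub>R w)) w \<bullet> a)"
    using \<phi> D by (simp add: add_ac)
  finally show ?thesis
    using that[of "y + s *\<^sub>R v + t *\<^sub>R w"] inball[of s t] s t by (simp add: D_def[abs_def])
qed

text \<open>The second difference is symmetric in \<open>v\<close> and \<open>w\<close>, so the two
  mixed derivatives agree at possibly different points arbitrarily close to \<open>y\<close>; their
  continuity moves the equality to \<open>y\<close>.\<close>

lemma second_derivative_symmetric:
  fixes f :: "'b::real_normed_vector \<Rightarrow> 'a::real_inner"
  assumes S: "open S" "y \<in> S" and f: "Ck_on 2 S f"
  shows "frechet_derivative (\<lambda>z. frechet_derivative f (at z) v) (at y) w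
    = frechet_derivative (\<lambda>z. frechet_derivative f (at z) w) (at y) v"
proof -
  define D2 where "D2 v w z = frechet_derivative (\<lambda>z. frechet_derivative f (at z) v) (at z) w" for v w z
  have f1: "f differentiable (at z)" and f2: "(\<lambda>z. frechet_derivative f (at z) v) differentiable (at z)"
    and cont: "continuous_on S (D2 v w)" if "z \<in> S" for z v w
    using f that by (auto simp: numeral_2_eq_2 D2_def[abs_def])
  have "D2 v w y \<bullet> a = D2 w v y \<bullet> a" for a
  proof (rule ccontr)
    assume ne: "D2 v w y \<bullet> a \<noteq> D2 w v y \<bullet> a"
    define e where "e = \<bar>D2 v w y \<bullet> a - D2 w v y \<bullet> a\<bar>"
    have "e > 0" using ne by (simp add: e_def)
    have "\<exists>d>0. \<forall>z\<in>ball y d. \<bar>D2 v w z \<bullet> a - D2 v w y \<bullet> a\<bar> < e / 2" for v w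
    proof -
      have "isCont (\<lambda>z. D2 v w z \<bullet> a) y"
        using cont S by (intro continuous_intros) (auto simp: continuous_on_eq_continuous_at)
      then obtain d where "d > 0" "\<And>z. dist z y < d \<Longrightarrow> dist (D2 v w z \<bullet> a) (D2 v w y \<bullet> a) < e / 2"
        using \<open>e > 0\<close> unfolding continuous_at_eps_delta by (meson half_gt_zero)
      then show ?thesis by (intro exI[of _ d]) (auto simp: dist_commute dist_real_def)
    qed
    then obtain d1 d2 where "d1 > 0" "d2 > 0"
      and d1: "\<And>z. z \<in> ball y d1 \<Longrightarrow> \<bar>D2 v w z \<bullet> a - D2 v w y \<bullet> a\<bar> < e / 2"
      and d2: "\<And>z. z \<in> ball y d2 \<Longrightarrow> \<bar>D2 w v z \<bullet> a - D2 w v y \<bullet> a\<bar> < e / 2"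
      by meson
    obtain d3 where "d3 > 0" and d3: "ball y d3 \<subseteq> S"
      using S by (meson open_contains_ball)
    define \<epsilon> where "\<epsilon> = min d1 (min d2 d3)"
    have "\<epsilon> > 0" using \<open>d1 > 0\<close> \<open>d2 > 0\<close> \<open>d3 > 0\<close> by (simp add: \<epsilon>_def)
    have sub: "ball y \<epsilon> \<subseteq> ball y d1" "ball y \<epsilon> \<subseteq> ball y d2" "ball y \<epsilon> \<subseteq> S"
      using d3 by (auto simp: \<epsilon>_def)
    \<comment> \<open>The added 1 keeps the denominator positive when \<open>v\<close> and
      \<open>w\<close> vanish and makes the required bound strict.\<close>
    define h where "h = \<epsilon> / (norm v + norm w + 1)"
    have pos: "norm v + norm w + 1 > 0" by (smt (verit) norm_ge_zero)
    then have h: "h > 0" "h * (norm v + norm w) < \<epsilon>"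
      using \<open>\<epsilon> > 0\<close> by (simp_all add: h_def field_simps)
    have diff: "\<exists>z\<in>ball y \<epsilon>. (f (y + h *\<^sub>R v + h *\<^sub>R w) - f (y + h *\<^sub>R v) - f (y + h *\<^sub>R w) + f y) \<bullet> a
        = h * h * (D2 v w z \<bullet> a)" if "h * (norm v + norm w) < \<epsilon>" for v w
    proof (rule second_difference[of y \<epsilon> f v h w a])
      show "f differentiable at z" "(\<lambda>z. frechet_derivative f (at z) v) differentiable at z"
        if "z \<in> ball y \<epsilon>" for z
        using that sub(3) f1 f2 by auto
    qed (use h that in \<open>auto simp: D2_def\<close>)
    from diff[OF h(2)] obtain z1 where z1: "z1 \<in> ball y \<epsilon>"
      "(f (y + h *\<^sub>R v + h *\<^sub>R w) - f (y + h *\<^sub>R v) - f (y + h *\<^sub>R w) + f y) \<bullet> a = h * h * (D2 v w z1 \<bullet> a)"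
      by auto
    have "h * (norm w + norm v) < \<epsilon>" using h by (simp add: add.commute)
    from diff[OF this] obtain z2 where z2: "z2 \<in> ball y \<epsilon>"
      "(f (y + h *\<^sub>R w + h *\<^sub>R v) - f (y + h *\<^sub>R w) - f (y + h *\<^sub>R v) + f y) \<bullet> a = h * h * (D2 w v z2 \<bullet> a)"
      by auto
    have "h * h * (D2 v w z1 \<bullet> a) = h * h * (D2 w v z2 \<bullet> a)"
      unfolding z1(2)[symmetric] z2(2)[symmetric] by (simp add: algebra_simps)
    then have "D2 v w z1 \<bullet> a = D2 w v z2 \<bullet> a" using h by simp
    then have "e \<le> \<bar>D2 v w z1 \<bullet> a - D2 v w y \<bullet> a\<bar> + \<bar>D2 w v z2 \<bullet> a - D2 w v y \<bullet> a\<bar>"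
      unfolding e_def by arith
    moreover have "\<bar>D2 v w z1 \<bullet> a - D2 v w y \<bullet> a\<bar> < e / 2" "\<bar>D2 w v z2 \<bullet> a - D2 w v y \<bullet> a\<bar> < e / 2"
      using z1 z2 sub d1 d2 by auto
    ultimately show False by linarith
  qed
  then have "D2 v w y = D2 w v y" by (metis vector_eq_rdot)
  then show ?thesis by (simp add: D2_def)
qed

text \<open>Constant coordinate fields are the test fields on which the defining conditions of the
  connections are evaluated below.\<close>

lemma smooth_on_const: "smooth_on S (\<lambda>x. a)"
proof -
  have "Ck_on k S (\<lambda>x. a)" for k and a :: 'b
    by (induction k arbitrary: a) simp_all
  then show ?thesis by (simp add: smooth_on_def)
qed

lemma smooth_on_imp_differentiable: "smooth_on S f \<Longrightarrow> x \<in> S \<Longrightarrow> f differentiable (at x)"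
  unfolding smooth_on_def by (drule spec[of _ 1]) simp

lemma frechet_derivative_blinfun_apply:
  assumes "F differentiable (at x)"
  shows "frechet_derivative (\<lambda>z. blinfun_apply (F z) v) (at x) = (\<lambda>u. frechet_derivative F (at x) u v)"
  using assms unfolding frechet_derivative_works
  by (intro frechet_derivative_at[symmetric]) (auto intro!: derivative_eq_intros)

lemma frechet_derivative_blinfun_apply2:
  assumes "F differentiable (at x)"
  shows "frechet_derivative (\<lambda>z. blinfun_apply (blinfun_apply (F z) v) w) (at x) = (\<lambda>u. frechet_derivative F (at x) u v w)"
  using assms unfolding frechet_derivative_works
  by (intro frechet_derivative_at[symmetric]) (auto intro!: derivative_eq_intros)

section \<open>Connections in coordinates\<close>

text \<open>On constant fields the derivatives of the fields disappear, and the condition becomes a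
  pointwise identity for the Christoffel symbols. The next lemmas proceed in the same way.\<close>

lemma metric_connection_coords:
  assumes "metric_connection A g \<Gamma>" and "riemannian_metric A g" and c: "c \<in> A" "x \<in> chart_image c"
  shows "frechet_derivative (g c) (at x) u v w = g c x (\<Gamma> c x u v) w + g c x v (\<Gamma> c x u w)"
proof -
  have "g c differentiable (at x)"
    using assms unfolding riemannian_metric_def by (blast intro: smooth_on_imp_differentiable)
  moreover have "frechet_derivative (\<lambda>z. g c z v w) (at x) u
      = g c x (cov \<Gamma> c (\<lambda>_. u) (\<lambda>_. v) x) w + g c x v (cov \<Gamma> c (\<lambda>_. u) (\<lambda>_. w) x)"
    using assms(1) c smooth_on_const[of "chart_image c"] unfolding metric_connection_def by blast
  ultimately show ?thesis
    by (simp add: cov_def frechet_derivative_blinfun_apply2)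
qed

lemma levi_civita_coords:
  assumes "levi_civita A g \<Gamma>" and c: "c \<in> A" "x \<in> chart_image c"
  shows "\<Gamma> c x u v = \<Gamma> c x v u"
proof -
  have "torsion \<Gamma> c (\<lambda>_. u) (\<lambda>_. v) x = 0"
    using assms smooth_on_const[of "chart_image c"] unfolding levi_civita_def by blast
  then show ?thesis by (simp add: torsion_def cov_def lie_bracket_def)
qed

text \<open>The fields made with \<open>endo_field\<close> are not constant, but their derivatives
  cancel between the covariant derivatives and the Lie bracket, leaving the antisymmetrized
  symbols.\<close>

lemma canonical_connection_torsion_coords:
  assumes "canonical_connection A J g \<Gamma>" and c: "c \<in> A" "x \<in> chart_image c"
  shows "\<Gamma> c x (J c x u) v - \<Gamma> c x v (J c x u) = \<Gamma> c x u (J c x v) - \<Gamma> c x (J c x v) u"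
proof -
  have "torsion \<Gamma> c (endo_field J c (\<lambda>_. u)) (\<lambda>_. v) x = torsion \<Gamma> c (\<lambda>_. u) (endo_field J c (\<lambda>_. v)) x"
    using assms smooth_on_const[of "chart_image c"] unfolding canonical_connection_def by blast
  then show ?thesis by (simp add: torsion_def cov_def lie_bracket_def endo_field_def)
qed

lemma cov_endo_coords:
  assumes "J c differentiable (at x)"
  shows "cov_endo \<Gamma> J c (\<lambda>_. u) (\<lambda>_. v) x
    = frechet_derivative (J c) (at x) u v + \<Gamma> c x u (J c x v) - J c x (\<Gamma> c x u v)"
  by (simp add: cov_endo_def cov_def endo_field_def[abs_def] frechet_derivative_blinfun_apply[OF assms])

lemma canonical_connection_parallel_coords:
  assumes "canonical_connection A J g \<Gamma>" and c: "c \<in> A" "x \<in> chart_image c" and "J c differentiable (at x)"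
  shows "frechet_derivative (J c) (at x) u v = J c x (\<Gamma> c x u v) - \<Gamma> c x u (J c x v)"
proof -
  have "cov_endo \<Gamma> J c (\<lambda>_. u) (\<lambda>_. v) x = 0"
    using assms smooth_on_const[of "chart_image c"]
    unfolding canonical_connection_def unitary_connection_def by blast
  then show ?thesis by (simp add: cov_endo_coords[of J, OF assms(4)] algebra_simps)
qed

lemma nearly_kaehler_coords:
  assumes "nearly_kaehler A J g \<Gamma>" and c: "c \<in> A" "x \<in> chart_image c" and "J c differentiable (at x)"
  shows "frechet_derivative (J c) (at x) v v = J c x (\<Gamma> c x v v) - \<Gamma> c x v (J c x v)"
proof -
  have "cov_endo \<Gamma> J c (\<lambda>_. v) (\<lambda>_. v) x = 0"
    using assms smooth_on_const[of "chart_image c"] unfolding nearly_kaehler_def by blast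
  then show ?thesis by (simp add: cov_endo_coords[of J, OF assms(4)] algebra_simps)
qed

lemma almost_hermitian_form:
  assumes "almost_hermitian A J g" "c \<in> A" "x \<in> chart_image c"
  shows "hermitian_form (g c x) (J c x)"
  using assms unfolding almost_hermitian_def riemannian_metric_def almost_complex_structure_def
  by unfold_locales auto

text \<open>The partial derivatives of \<open>g c\<close> and \<open>J c\<close> enter the
  conditions on both connections alike and drop out of the difference, to which
  \<open>connection_difference_vanishes\<close> applies.\<close>

lemma canonical_connection_trace:
  assumes nk: "nearly_kaehler A J g LC" and can: "canonical_connection A J g can"
    and c: "c \<in> A" "x \<in> chart_image c"
  shows "g c x (can c x u v) (J c x v) = g c x (LC c x u v) (J c x v)"
proof -
  have ah: "almost_hermitian A J g" using nk by (simp add: nearly_kaehler_def)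
  interpret hermitian_form "g c x" "J c x" by (rule almost_hermitian_form[OF ah c])
  have J: "J c differentiable (at x)"
    using ah c unfolding almost_hermitian_def almost_complex_structure_def
    by (blast intro: smooth_on_imp_differentiable)
  have metric: "riemannian_metric A g" using ah by (simp add: almost_hermitian_def)
  have lc: "levi_civita A g LC" using nk by (simp add: nearly_kaehler_def)
  have mLC: "metric_connection A g LC" using lc by (simp add: levi_civita_def)
  have mcan: "metric_connection A g can"
    using can by (simp add: canonical_connection_def unitary_connection_def)
  have "g c x ((can c x - LC c x) u v) (J c x v) = 0"
  proof (rule connection_difference_vanishes)
    show "g c x ((can c x - LC c x) u v) w = - g c x v ((can c x - LC c x) u w)" for u v w
      using metric_connection_coords[OF mLC metric c, of u v w] metric_connection_coords[OF mcan metric c, of u v w]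
      by (simp add: blinfun.bilinear_simps)
    show "(can c x - LC c x) (J c x u) v - (can c x - LC c x) v (J c x u)
      = (can c x - LC c x) u (J c x v) - (can c x - LC c x) (J c x v) u" for u v
      using canonical_connection_torsion_coords[OF can c, of u v]
        levi_civita_coords[OF lc c, of "J c x u" v] levi_civita_coords[OF lc c, of u "J c x v"]
      by (simp add: blinfun.bilinear_simps)
    show "J c x ((can c x - LC c x) v v) = (can c x - LC c x) v (J c x v)" for v
      using nearly_kaehler_coords[OF nk c J, of v] canonical_connection_parallel_coords[OF can c J, of v v]
      by (simp add: blinfun.bilinear_simps algebra_simps)
  qed
  then show ?thesis by (simp add: blinfun.bilinear_simps)
qed

lemma has_derivative_vec_lambda:
  fixes F :: "'n::finite \<Rightarrow> 'z::real_normed_vector \<Rightarrow> 'a::euclidean_space"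
  assumes "\<And>i. (F i has_derivative F' i) (at x)"
  shows "((\<lambda>z. \<chi> i. F i z) has_derivative (\<lambda>t. \<chi> i. F' i t)) (at x)"
proof -
  have "bounded_linear (axis i :: 'a \<Rightarrow> 'a^'n)" for i
    by (intro linear_conv_bounded_linear[THEN iffD1] linearI) (auto simp: vec_eq_iff axis_def)
  then have "((\<lambda>z. \<Sum>i\<in>UNIV. axis i (F i z)) has_derivative (\<lambda>t. \<Sum>i\<in>UNIV. axis i (F' i t))) (at x)"
    by (intro has_derivative_sum bounded_linear.has_derivative[of "axis i" for i] assms)
  moreover have "(\<chi> i. v i) = (\<Sum>i\<in>UNIV. axis i (v i))" for v :: "'n \<Rightarrow> 'a"
    by (simp add: vec_eq_iff axis_def)
  ultimately show ?thesis by (simp only:)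
qed

lemma filterlim_line:
  fixes y w :: "'b::real_normed_vector"
  shows "filterlim (\<lambda>t. y + t *\<^sub>R w) (nhds y) (nhds 0)"
proof -
  have "((\<lambda>t. y + t *\<^sub>R w) \<longlongrightarrow> y + 0 *\<^sub>R w) (nhds 0)"
    by (intro tendsto_intros filterlim_ident)
  then show ?thesis by simp
qed

section \<open>Lagrangian immersions in coordinates\<close>

text \<open>One pair of charts: \<open>f\<close> is the inclusion in coordinates and
  \<open>\<Gamma>\<close> holds the Levi-Civita symbols. The geometric hypotheses appear as
  pointwise identities, without atlases or test fields.\<close>

locale lagrangian_chart =
  fixes S :: "(real^'n) set" and f :: "real^'n \<Rightarrow> 'a::euclidean_space" and U :: "'a set"
    and g :: "'a \<Rightarrow> 'a \<Rightarrow>\<^sub>L 'a \<Rightarrow>\<^sub>L real" and J :: "'a \<Rightarrow> 'a \<Rightarrow>\<^sub>L 'a" and \<Gamma> :: "'a \<Rightarrow> 'a \<Rightarrow>\<^sub>L 'a \<Rightarrow>\<^sub>L 'a"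
  assumes open_S: "open S" and smooth_f: "smooth_on S f" and f_in: "y \<in> S \<Longrightarrow> f y \<in> U"
    and inj: "y \<in> S \<Longrightarrow> inj (frechet_derivative f (at y))"
    and hermitian: "x \<in> U \<Longrightarrow> hermitian_form (g x) (J x)"
    and g_diff: "x \<in> U \<Longrightarrow> g differentiable (at x)"
    and J_diff: "x \<in> U \<Longrightarrow> J differentiable (at x)"
    and metric: "x \<in> U \<Longrightarrow> frechet_derivative g (at x) u v w = g x (\<Gamma> x u v) w + g x v (\<Gamma> x u w)"
    and torsion_free: "x \<in> U \<Longrightarrow> \<Gamma> x u v = \<Gamma> x v u"
    and nearly: "x \<in> U \<Longrightarrow> frechet_derivative J (at x) v v = J x (\<Gamma> x v v) - \<Gamma> x v (J x v)"
    and lagrangian: "y \<in> S \<Longrightarrow>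
      g (f y) (J (f y) (frechet_derivative f (at y) a)) (frechet_derivative f (at y) b) = 0"
    and dim: "DIM('a) = 2 * CARD('n)"
begin

section \<open>Covariant derivatives of tangent fields and the cubic form\<close>

definition D :: "real^'n \<Rightarrow> real^'n \<Rightarrow> 'a" where
  "D y = frechet_derivative f (at y)"

definition D2 :: "real^'n \<Rightarrow> real^'n \<Rightarrow> real^'n \<Rightarrow> 'a" where
  "D2 y v w = frechet_derivative (\<lambda>z. D z v) (at y) w"

text \<open>The covariant derivative in direction \<open>v\<close> of the tangent field with
  constant coordinates \<open>w\<close>; \<open>D2\<close> takes the direction last, hence the
  swapped arguments.\<close>

definition cov_tangent :: "real^'n \<Rightarrow> real^'n \<Rightarrow> real^'n \<Rightarrow> 'a" where
  "cov_tangent y v w = D2 y w v + \<Gamma> (f y) (D y v) (D y w)"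

text \<open>The second fundamental form read as a cubic form on the submanifold: \<open>J\<close>
  sends tangent vectors to normal ones, so only the normal part of \<open>cov_tangent\<close>
  contributes.\<close>

definition cubic :: "real^'n \<Rightarrow> real^'n \<Rightarrow> real^'n \<Rightarrow> real^'n \<Rightarrow> real" where
  "cubic y v w u = g (f y) (cov_tangent y v w) (J (f y) (D y u))"

lemma D_derivative: "y \<in> S \<Longrightarrow> (f has_derivative D y) (at y)"
  using smooth_on_imp_differentiable[OF smooth_f] by (simp add: D_def frechet_derivative_works)

lemma D_linear: "y \<in> S \<Longrightarrow> linear (D y)"
  using D_derivative has_derivative_linear by blast

lemma D2_derivative:
  assumes "y \<in> S" shows "((\<lambda>z. D z v) has_derivative D2 y v) (at y)"
proof -
  have "Ck_on 2 S f" using smooth_f by (simp add: smooth_on_def)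
  then have "(\<lambda>z. D z v) differentiable (at y)"
    using assms by (simp add: numeral_2_eq_2 D_def)
  then show ?thesis by (simp add: frechet_derivative_works D2_def[abs_def])
qed

lemma D2_symmetric:
  assumes "y \<in> S" shows "D2 y v w = D2 y w v"
proof -
  have "Ck_on 2 S f" using smooth_f by (simp add: smooth_on_def)
  from second_derivative_symmetric[OF open_S assms this] show ?thesis by (simp add: D2_def D_def)
qed

lemma D2_linear_right: "y \<in> S \<Longrightarrow> linear (D2 y v)"
  using D2_derivative has_derivative_linear by blast

text \<open>Linearity in the first argument is inherited from the second by symmetry.\<close>

lemma D2_bilinear:
  assumes "y \<in> S" shows "bilinear (D2 y)"
proof -
  have "(\<lambda>v. D2 y v w) = D2 y w" for w
    using D2_symmetric[OF assms] by auto
  then show ?thesis using D2_linear_right[OF assms] by (simp add: bilinear_def)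
qed

lemma cov_tangent_bilinear:
  assumes "y \<in> S" shows "bilinear (cov_tangent y)"
proof -
  note D2 = D2_bilinear[OF assms] and D = D_linear[OF assms]
  show ?thesis
    by (auto simp: bilinear_def cov_tangent_def bilinear_ladd[OF D2] bilinear_radd[OF D2]
        bilinear_lmul[OF D2] bilinear_rmul[OF D2] linear_add[OF D] linear_scale[OF D]
        blinfun.bilinear_simps algebra_simps intro!: linearI)
qed

lemma cov_tangent_symmetric: "y \<in> S \<Longrightarrow> cov_tangent y v w = cov_tangent y w v"
  using torsion_free[OF f_in] D2_symmetric by (simp add: cov_tangent_def)

text \<open>\<open>D2_derivative\<close> differentiates \<open>D z v\<close> for fixed
  \<open>v\<close> only, so \<open>p z\<close> is expanded along the axes before the product rule is
  applied.\<close>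

lemma field_derivative:
  assumes y: "y \<in> S" and p: "(p has_derivative p') (at y)"
  shows "((\<lambda>z. D z (p z)) has_derivative (\<lambda>w. D2 y (p y) w + D y (p' w))) (at y)"
proof (rule has_derivative_transform_within_open[OF _ open_S y])
  have p_i: "((\<lambda>z. p z $ i) has_derivative (\<lambda>w. p' w $ i)) (at y)" for i
    by (rule bounded_linear.has_derivative[OF bounded_linear_vec_nth p])
  have expand: "T v = (\<Sum>i\<in>UNIV. v $ i *\<^sub>R T (axis i 1))" if "linear T" for v :: "real^'n" and T :: "real^'n \<Rightarrow> 'a"
    using basis_expansion[of v] linear_sum[OF that, of "\<lambda>i. v $ i *\<^sub>R axis i 1" UNIV]
    by (simp add: scalar_mult_eq_scaleR linear_scale[OF that])
  have "((\<lambda>z. \<Sum>i\<in>UNIV. p z $ i *\<^sub>R D z (axis i 1)) has_derivative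
      (\<lambda>w. \<Sum>i\<in>UNIV. p y $ i *\<^sub>R D2 y (axis i 1) w + p' w $ i *\<^sub>R D y (axis i 1))) (at y)"
    by (intro has_derivative_sum has_derivative_scaleR p_i D2_derivative y)
  moreover have "(\<Sum>i\<in>UNIV. p y $ i *\<^sub>R D2 y (axis i 1) w + p' w $ i *\<^sub>R D y (axis i 1))
      = D2 y (p y) w + D y (p' w)" for w
    using D2_bilinear[OF y] expand[of "\<lambda>v. D2 y v w" "p y"] expand[OF D_linear[OF y], of "p' w"]
    by (simp add: sum.distrib bilinear_def)
  ultimately show "((\<lambda>z. \<Sum>i\<in>UNIV. p z $ i *\<^sub>R D z (axis i 1)) has_derivative
      (\<lambda>w. D2 y (p y) w + D y (p' w))) (at y)" by simp
  show "(\<Sum>i\<in>UNIV. p z $ i *\<^sub>R D z (axis i 1)) = D z (p z)" if "z \<in> S" for z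
    using expand[OF D_linear[OF that], of "p z"] by simp
qed

lemma g_derivative: "y \<in> S \<Longrightarrow> ((\<lambda>z. g (f z)) has_derivative (\<lambda>w. frechet_derivative g (at (f y)) (D y w))) (at y)"
  using diff_chain_at[OF D_derivative, of y g] g_diff[OF f_in, of y]
  by (simp add: frechet_derivative_works o_def)

lemma J_derivative: "y \<in> S \<Longrightarrow> ((\<lambda>z. J (f z)) has_derivative (\<lambda>w. frechet_derivative J (at (f y)) (D y w))) (at y)"
  using diff_chain_at[OF D_derivative, of y J] J_diff[OF f_in, of y]
  by (simp add: frechet_derivative_works o_def)

lemma lagrangian_D: "y \<in> S \<Longrightarrow> g (f y) (J (f y) (D y v)) (D y w) = 0"
  using lagrangian by (simp add: D_def)

lemma lagrangian_D': "y \<in> S \<Longrightarrow> g (f y) (D y v) (J (f y) (D y w)) = 0"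
  by (subst hermitian_form.sym[OF hermitian[OF f_in]]) (simp_all add: lagrangian_D)

lemma cubic_symmetric:
  assumes y: "y \<in> S"
  shows "cubic y a a b = cubic y b a a"
proof -
  interpret hermitian_form "g (f y)" "J (f y)" by (rule hermitian[OF f_in[OF y]])
  let ?F = "\<lambda>z. g (f z) (J (f z) (D z a)) (D z b)"
  define F' where "F' w = frechet_derivative g (at (f y)) (D y w) (J (f y) (D y a)) (D y b)
      + g (f y) (frechet_derivative J (at (f y)) (D y w) (D y a) + J (f y) (D2 y a w)) (D y b)
      + g (f y) (J (f y) (D y a)) (D2 y b w)" for w
  have "(?F has_derivative F') (at y)"
    unfolding F'_def
    by (rule derivative_eq_intros g_derivative J_derivative D2_derivative y refl)+
      (simp add: blinfun.bilinear_simps algebra_simps)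
  moreover have "(?F has_derivative (\<lambda>_. 0)) (at y)"
    by (rule has_derivative_transform_within_open[OF has_derivative_const open_S y]) (simp add: lagrangian_D)
  ultimately have "F' = (\<lambda>_. 0)" by (rule has_derivative_unique)
  \<comment> \<open>In direction \<open>a\<close> the derivative of \<open>J\<close> is taken along
    the very vector it acts on, so \<open>nearly\<close> applies. The term with
    \<open>\<Gamma>\<close> applied to \<open>D y a\<close> and its image under \<open>J\<close>
    then cancels against the one from \<open>metric\<close>.\<close>
  then have "F' a = 0" by simp
  then have "g (f y) (J (f y) (cov_tangent y a a)) (D y b) + g (f y) (J (f y) (D y a)) (cov_tangent y a b) = 0"
    unfolding F'_def metric[OF f_in[OF y]] nearly[OF f_in[OF y]]
    by (simp add: cov_tangent_def blinfun.bilinear_simps)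
  then have "cubic y a a b = cubic y a b a"
    using sym[of "J (f y) (D y a)" "cov_tangent y a b"] by (simp add: cubic_def J_skew)
  then show ?thesis
    by (simp add: cubic_def cov_tangent_symmetric[OF y, of a b])
qed

lemma cubic_bilinear:
  assumes "y \<in> S" shows "bilinear (\<lambda>v w. cubic y v w u)"
proof -
  note K = cov_tangent_bilinear[OF assms]
  show ?thesis
    by (auto simp: bilinear_def cubic_def bilinear_ladd[OF K] bilinear_radd[OF K]
        bilinear_lmul[OF K] bilinear_rmul[OF K] blinfun.bilinear_simps intro!: linearI)
qed

section \<open>Induced metric and orthonormal tangent frames\<close>

definition induced :: "real^'n \<Rightarrow> real^'n \<Rightarrow> real^'n \<Rightarrow> real" where
  "induced y v w = g (f y) (D y v) (D y w)"

lemma induced_bilinear: "y \<in> S \<Longrightarrow> bilinear (induced y)"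
  using D_linear[of y] unfolding bilinear_def induced_def
  by (auto intro!: linearI simp: linear_add linear_scale blinfun.bilinear_simps)

lemma induced_symmetric: "y \<in> S \<Longrightarrow> induced y v w = induced y w v"
  unfolding induced_def by (rule hermitian_form.sym[OF hermitian[OF f_in]])

lemma induced_pos:
  assumes "y \<in> S" "a \<noteq> 0" shows "induced y a a > 0"
proof -
  have "D y a \<noteq> 0"
    using assms inj[of y] linear_injective_0[OF D_linear] by (auto simp: D_def)
  then show ?thesis
    using hermitian_form.pos[OF hermitian[OF f_in]] assms by (simp add: induced_def)
qed

lemma induced_differentiable: "y \<in> S \<Longrightarrow> (\<lambda>z. induced z a b) differentiable (at y)"
  unfolding induced_def differentiable_def
  by (rule exI, (rule derivative_eq_intros g_derivative D2_derivative refl | assumption)+)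

text \<open>Gram-Schmidt for the induced metric, which is positive because \<open>f\<close> is an
  immersion. The frame is recorded by its coordinates in the submanifold, not by vectors of the
  ambient space.\<close>

lemma orthonormal_tangent_frame:
  assumes y: "y \<in> S"
  obtains p :: "'n \<Rightarrow> real^'n \<Rightarrow> real^'n" where "\<And>i. p i differentiable (at y)"
    and "\<forall>\<^sub>F z in nhds y. z \<in> S \<and> (\<forall>i j. induced z (p i z) (p j z) = (if i = j then 1 else 0))"
proof -
  have S: "\<forall>\<^sub>F z in nhds y. z \<in> S" using open_S y by (rule eventually_nhds_in_open)
  then have "\<forall>\<^sub>F z in nhds y. bilinear (induced z) \<and> (\<forall>a b. induced z a b = induced z b a)
      \<and> (\<forall>a. a \<noteq> 0 \<longrightarrow> induced z a a > 0)"
    by eventually_elim (auto intro: induced_bilinear induced_pos induced_symmetric)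
  then obtain p :: "'n \<Rightarrow> real^'n \<Rightarrow> real^'n" where "\<And>i. p i differentiable at y"
    and "\<forall>\<^sub>F z in nhds y. \<forall>i j. induced z (p i z) (p j z) = (if i = j then 1 else 0)"
    using differentiable_orthonormalization induced_differentiable[OF y] by blast
  with S show ?thesis by (intro that[of p]) (auto elim: eventually_elim2)
qed

text \<open>Needed so that the frame lies over the Gauss map under
  \<open>frame_proj\<close>.\<close>

lemma frame_span:
  assumes y: "y \<in> S" and p: "\<And>i j. induced y (p i) (p j) = (if i = j then 1 else 0)"
  shows "span (range (\<lambda>i::'n. D y (p i))) = range (D y)"
proof
  show "span (range (\<lambda>i. D y (p i))) \<subseteq> range (D y)"
    using linear_subspace_image[OF D_linear[OF y] subspace_UNIV] by (intro span_minimal) auto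
  have "D y v \<in> span (range (\<lambda>i. D y (p i)))" for v
  proof -
    have "v = (\<Sum>i\<in>UNIV. induced y v (p i) *\<^sub>R p i)"
      by (rule orthonormal_expansion[OF induced_bilinear[OF y] p]) simp
    from arg_cong[OF this, of "D y"]
    have "D y v = (\<Sum>i\<in>UNIV. induced y v (p i) *\<^sub>R D y (p i))"
      by (simp add: linear_sum[OF D_linear[OF y]] linear_scale[OF D_linear[OF y]])
    also have "\<dots> \<in> span (range (\<lambda>i. D y (p i)))"
      by (intro span_sum span_scale span_base) auto
    finally show ?thesis .
  qed
  then show "range (D y) \<subseteq> span (range (\<lambda>i. D y (p i)))" by auto
qed

text \<open>Orthogonality of the frame to its image under \<open>J\<close> is the Lagrangian
  condition.\<close>

lemma frame_unitary:
  assumes y: "y \<in> S" and p: "\<And>i j. induced y (p i) (p j) = (if i = j then 1 else 0)"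
  shows "hermitian_form.unitary_at (g (f y)) (J (f y)) (\<chi> i::'n. D y (p i))"
  using p lagrangian_D'[OF y]
  by (simp add: induced_def hermitian_form.unitary_at_def[OF hermitian[OF f_in[OF y]]])

lemma frame_orth_proj:
  assumes y: "y \<in> S" and p: "\<And>i j. induced y (p i) (p j) = (if i = j then 1 else 0)"
  shows "orth_proj (g (f y)) (range (D y))
    = (\<Sum>i\<in>(UNIV::'n set). blinfun_scaleR_left (D y (p i)) o\<^sub>L g (f y) (D y (p i)))"
  unfolding frame_span[OF y p, symmetric]
  using p[unfolded induced_def]
  by (rule hermitian_form.orth_proj_eq_sum[OF hermitian[OF f_in[OF y]]])

end

text \<open>Multiplying by \<open>- \<i>\<close> makes the imaginary part of the trace the real
  part; the imaginary part of a diagonal coefficient is the component of the covariant derivative of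
  \<open>e $ j\<close> along \<open>J c x (e $ j)\<close>.\<close>

lemma Re_gamma_form:
  fixes e e' :: "'a::euclidean_space^'n"
  assumes h: "hermitian_form (g c x) (J c x)" and e: "hermitian_form.unitary_at (g c x) (J c x) e"
    and dim: "DIM('a) = 2 * CARD('n)"
  shows "Re (gamma_form J \<Gamma> c (x, e) (x', e')) = (\<Sum>j\<in>UNIV. g c x (e' $ j + \<Gamma> c x x' (e $ j)) (J c x (e $ j)))"
  using hermitian_form.unitary_coefficients[OF h e dim, of "\<lambda>j. e' $ j + \<Gamma> c x x' (e $ j)"]
  by (simp add: gamma_form_def connection_form_def trace_def Im_sum)

context lagrangian_chart
begin

text \<open>The tangential projection pairs to zero with images of tangent vectors under
  \<open>J\<close>, so \<open>II\<close> may be replaced by \<open>cov_tangent\<close>. The sign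
  comes from moving \<open>J\<close> to the other argument.\<close>

lemma mean_curvature_cubic:
  fixes p :: "'n \<Rightarrow> real^'n"
  assumes y: "y \<in> S" and p: "\<And>i j. induced y (p i) (p j) = (if i = j then 1 else 0)"
  defines "II \<equiv> \<lambda>a b. let Z = cov_tangent y a b in Z - orth_proj (g (f y)) (range (D y)) Z"
  shows "g (f y) (J (f y) (\<Sum>i\<in>UNIV. \<Sum>j\<in>UNIV.
      matrix_inv (\<chi> i j. induced y (axis i 1) (axis j 1)) $ i $ j *\<^sub>R II (axis i 1) (axis j 1))) (D y w)
    = - (\<Sum>k\<in>UNIV. cubic y (p k) (p k) w)"
proof -
  interpret hermitian_form "g (f y)" "J (f y)" by (rule hermitian[OF f_in[OF y]])
  have normal: "g (f y) (J (f y) (II a b)) (D y w) = - cubic y a b w" for a b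
  proof -
    have "g (f y) (orth_proj (g (f y)) (range (D y)) v) (J (f y) (D y w)) = 0" for v
      unfolding frame_orth_proj[OF y p]
      by (simp add: blinfun.sum_left blinfun.bilinear_simps lagrangian_D'[OF y])
    then show ?thesis
      by (simp add: II_def Let_def cubic_def J_skew blinfun.bilinear_simps)
  qed
  show ?thesis
    using matrix_inv_orthonormal_trace[OF induced_bilinear[OF y] cubic_bilinear[OF y] p, of w]
    by (simp add: blinfun.sum_left blinfun.sum_right blinfun.bilinear_simps normal sum_negf)
qed

text \<open>The term \<open>D y (q j)\<close>, coming from the changing coefficients of the frame,
  is tangent and pairs to zero with \<open>J\<close> of a tangent vector. What remains is
  \<open>cubic y w (p j) (p j)\<close>, and \<open>cubic_symmetric\<close> moves \<open>w\<close> to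
  the last place.\<close>

lemma frame_connection_trace:
  fixes p :: "'n \<Rightarrow> real^'n"
  assumes y: "y \<in> S"
    and B: "\<And>u v. g (f y) (B u v) (J (f y) v) = g (f y) (\<Gamma> (f y) u v) (J (f y) v)"
  shows "(\<Sum>j\<in>UNIV. g (f y) (D2 y (p j) w + D y (q j) + B (D y w) (D y (p j))) (J (f y) (D y (p j))))
    = (\<Sum>j\<in>UNIV. cubic y (p j) (p j) w)"
  unfolding cubic_symmetric[OF y]
  by (simp add: cubic_def cov_tangent_def blinfun.bilinear_simps B lagrangian_D'[OF y])

end

section \<open>The Maslov form of a Lagrangian submanifold\<close>

text \<open>The topology of \<open>Y\<close> may be finer than the subspace topology; continuity of
  the inclusion makes the intersection of the two chart domains open in \<open>Y\<close>, and the
  chart \<open>d\<close> carries it to an open set.\<close>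

lemma open_overlap:
  assumes "submanifold Y B X A" "d \<in> B" "c \<in> A"
  shows "open (overlap d c)"
proof -
  have Y: "openin Y (fst d)" "open (chart_image d)"
    "homeomorphic_map (subtopology Y (fst d)) (top_of_set (chart_image d)) (snd d)"
    and X: "openin X (fst c)" and incl: "continuous_map Y X id"
    using assms unfolding submanifold_def smooth_manifold_def by auto
  have "openin Y {p \<in> topspace Y. id p \<in> fst c}"
    using incl X by (rule openin_continuous_map_preimage)
  then have "openin Y (fst d \<inter> {p \<in> topspace Y. id p \<in> fst c})"
    using Y(1) by blast
  moreover have "fst d \<inter> {p \<in> topspace Y. id p \<in> fst c} = fst d \<inter> fst c"
    using openin_subset[OF Y(1)] by auto
  ultimately have "openin (subtopology Y (fst d)) (fst d \<inter> fst c)"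
    by (simp add: openin_open_subtopology[OF Y(1)])
  then have "openin (top_of_set (chart_image d)) (snd d ` (fst d \<inter> fst c))"
    using homeomorphic_map_openness_eq[OF Y(3)] by blast
  then show ?thesis
    using Y(2) openin_open_trans by (auto simp: overlap_def)
qed

lemma chart_change_in_chart_image:
  assumes "submanifold Y B X A" "d \<in> B" "y \<in> overlap d c"
  shows "chart_change d c y \<in> chart_image c"
proof -
  have Y: "openin Y (fst d)"
    "homeomorphic_map (subtopology Y (fst d)) (top_of_set (chart_image d)) (snd d)"
    using assms unfolding submanifold_def smooth_manifold_def by auto
  then have "inj_on (snd d) (fst d)"
    using homeomorphic_imp_injective_map[OF Y(2)] openin_subset[OF Y(1)] by (simp add: inf.absorb2)
  then show ?thesis
    using assms(3) by (auto simp: overlap_def chart_change_def chart_inv_def chart_image_def)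
qed

lemma lagrangian_chart_of_submanifold:
  fixes L :: "('m, real^'n) chart set" and M :: "('m, 'a::euclidean_space) chart set"
  assumes nk: "nearly_kaehler M J g LC" and sub: "submanifold Y L X M" and lag: "lagrangian L M J g"
    and d: "d \<in> L" and c: "c \<in> M"
  shows "lagrangian_chart (overlap d c) (chart_change d c) (chart_image c) (g c) (J c) (LC c)"
proof (rule lagrangian_chart.intro)
  have ah: "almost_hermitian M J g" and lc: "levi_civita M g LC"
    using nk by (auto simp: nearly_kaehler_def)
  then have metric: "riemannian_metric M g" and J: "almost_complex_structure M J"
    and mc: "metric_connection M g LC"
    by (auto simp: almost_hermitian_def levi_civita_def)
  show "open (overlap d c)" by (rule open_overlap[OF sub d c])
  show "smooth_on (overlap d c) (chart_change d c)"
    using sub d c by (simp add: submanifold_def)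
  show "chart_change d c y \<in> chart_image c" if "y \<in> overlap d c" for y
    by (rule chart_change_in_chart_image[OF sub d that])
  show "inj (frechet_derivative (chart_change d c) (at y))" if "y \<in> overlap d c" for y
    using sub d c that by (simp add: submanifold_def)
  show "hermitian_form (g c x) (J c x)" if "x \<in> chart_image c" for x
    by (rule almost_hermitian_form[OF ah c that])
  show "g c differentiable at x" if "x \<in> chart_image c" for x
    using metric c that unfolding riemannian_metric_def by (blast intro: smooth_on_imp_differentiable)
  show J_diff: "J c differentiable at x" if "x \<in> chart_image c" for x
    using J c that unfolding almost_complex_structure_def by (blast intro: smooth_on_imp_differentiable)
  show "frechet_derivative (g c) (at x) u v w = g c x (LC c x u v) w + g c x v (LC c x u w)"
    if "x \<in> chart_image c" for x u v w
    by (rule metric_connection_coords[OF mc metric c that])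
  show "LC c x u v = LC c x v u" if "x \<in> chart_image c" for x u v
    by (rule levi_civita_coords[OF lc c that])
  show "frechet_derivative (J c) (at x) v v = J c x (LC c x v v) - LC c x v (J c x v)"
    if "x \<in> chart_image c" for x v
    by (rule nearly_kaehler_coords[OF nk c that J_diff[OF that]])
  show "g c (chart_change d c y) (J c (chart_change d c y) (frechet_derivative (chart_change d c) (at y) a))
      (frechet_derivative (chart_change d c) (at y) b) = 0" if "y \<in> overlap d c" for y a b
    using lag d c that by (simp add: lagrangian_def fundamental_form_def tangent_map_def)
  show "DIM('a) = 2 * CARD('n)" using lag by (simp add: lagrangian_def)
qed

theorem proposition3p3:
  fixes X :: "'m topology" and M :: "('m, 'a::euclidean_space) chart set"
    and J :: "('m, 'a) endo" and g :: "('m, 'a) metric"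
    and LC can :: "('m, 'a) christoffel"
    and gamma_bar :: "('m, 'a) lag_form"
    and Y :: "'m topology" and L :: "('m, real^'n) chart set"
  assumes "smooth_manifold X M" and "DIM('a) = 2 * CARD('n)"
    and "nearly_kaehler M J g LC"
    and "canonical_connection M J g can"
    and "lag_one_form M J g gamma_bar"
    and "pulls_back_to_gamma TYPE('n) M J g can gamma_bar"
    and "submanifold Y L X M" and "lagrangian L M J g"
  shows "\<forall>d\<in>L. \<forall>c\<in>M. \<forall>y\<in>overlap d c. \<forall>w.
    - 2 * L_omega J g d c (mean_curvature g LC d c) y w = maslov_form g gamma_bar d c y w"
proof (intro ballI allI)
  fix d c y w
  assume d: "d \<in> L" and c: "c \<in> M" and y: "y \<in> overlap d c"
  define f where "f = chart_change d c"
  interpret lagrangian_chart "overlap d c" f "chart_image c" "g c" "J c" "LC c"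
    unfolding f_def by (rule lagrangian_chart_of_submanifold[OF assms(3,7,8) d c])
  have tangent: "tangent_map d c = D"
    by (simp add: fun_eq_iff tangent_map_def D_def flip: f_def)
  \<comment> \<open>The frame is needed on a neighbourhood, since it will be used to differentiate
    the Gauss map at \<open>y\<close>.\<close>
  obtain p :: "'n \<Rightarrow> real^'n \<Rightarrow> real^'n" where p_diff: "\<And>i. p i differentiable (at y)"
    and p_ev: "\<forall>\<^sub>F z in nhds y. z \<in> overlap d c \<and> (\<forall>i j. induced z (p i z) (p j z) = (if i = j then 1 else 0))"
    using orthonormal_tangent_frame[OF y] by blast
  have p: "induced y (p i y) (p j y) = (if i = j then 1 else 0)" for i j
    using eventually_nhds_x_imp_x[OF p_ev] by blast

  \<comment> \<open>Left-hand side: the minus sign will cancel against that of the factor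
    \<open>- 2\<close>.\<close>
  have "L_omega J g d c (mean_curvature g LC d c) y w = - (\<Sum>k\<in>UNIV. cubic y (p k y) (p k y) w)"
    using mean_curvature_cubic[OF y p, of w]
    by (simp add: L_omega_def fundamental_form_def mean_curvature_def second_fundamental_form_def
        induced_metric_def cov_along_def tangent_space_def tangent induced_def cov_tangent_def D2_def
        flip: f_def)

  define p' where "p' i = frechet_derivative (p i) (at y)" for i
  have p': "(p i has_derivative p' i) (at y)" for i
    using p_diff[of i] by (simp add: p'_def frechet_derivative_works)
  define E where "E i z = D z (p i z)" for i z
  define E' where "E' i v = D2 y (p i y) v + D y (p' i v)" for i v
  have E': "(E i has_derivative E' i) (at y)" for i
    unfolding E_def[abs_def] E'_def[abs_def] by (rule field_derivative[OF y p'])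

  define q where "q z = lag_embed g c (gauss_map d c z)" for z
  \<comment> \<open>Near \<open>y\<close> the embedded Gauss map is an explicit expression in the
    frame. Its differentiability has to be proved, because \<open>maslov_form\<close> refers to its
    Frechet derivative.\<close>
  have q_eq: "\<forall>\<^sub>F z in nhds y. (f z, \<Sum>i\<in>UNIV. blinfun_scaleR_left (E i z) o\<^sub>L g c (f z) (E i z)) = q z"
    using p_ev
  proof eventually_elim
    case (elim z)
    then show ?case
      using frame_orth_proj[of z "\<lambda>i. p i z"]
      by (simp add: q_def lag_embed_def gauss_map_def tangent_space_def tangent E_def flip: f_def)
  qed
  have "(\<lambda>z. (f z, \<Sum>i\<in>UNIV. blinfun_scaleR_left (E i z) o\<^sub>L g c (f z) (E i z))) differentiable (at y)"
  proof (intro differentiable_Pair differentiable_sum ballI)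
    show "f differentiable at y" using D_derivative[OF y] by (rule differentiableI)
    fix i
    have "(\<lambda>z. blinfun_scaleR_left (E i z)) differentiable at y"
      using bounded_linear.has_derivative[OF bounded_linear_blinfun_scaleR_left E'] by (rule differentiableI)
    moreover have "(\<lambda>z. g c (f z) (E i z)) differentiable at y"
      using bounded_bilinear.FDERIV[OF bounded_bilinear_blinfun_apply g_derivative[OF y] E'] by (rule differentiableI)
    ultimately show "(\<lambda>z. blinfun_scaleR_left (E i z) o\<^sub>L g c (f z) (E i z)) differentiable at y"
      using bounded_bilinear.FDERIV[OF bounded_bilinear_blinfun_compose]
      unfolding differentiable_def by blast
  qed simp
  then have "q differentiable (at y)"
    by (rule differentiable_transform_nhds) (rule q_eq)
  then have q': "(q has_derivative frechet_derivative q (at y)) (at y)"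
    by (simp add: frechet_derivative_works)

  \<comment> \<open>A coordinate line with velocity \<open>w\<close>: the Maslov form differentiates
    the Gauss map, whereas the hypothesis on \<open>gamma_bar\<close> is tested on curves of unitary
    frames.\<close>
  define l where "l t = y + t *\<^sub>R w" for t
  have l': "(l has_vector_derivative w) (at 0)"
    unfolding l_def[abs_def] by (auto intro!: derivative_eq_intros)
  have l_lim: "filterlim l (nhds y) (nhds 0)"
    unfolding l_def[abs_def] by (rule filterlim_line)
  have l0: "l 0 = y" by (simp add: l_def)
  have along: "((\<lambda>t. F (l t)) has_vector_derivative F' w) (at 0)"
    if "(F has_derivative F') (at y)" for F :: "real^'n \<Rightarrow> 'e::real_normed_vector" and F'
    using vector_derivative_diff_chain_within[of l w 0 UNIV F F'] l' that
    by (simp add: l0 o_def has_derivative_at_withinI)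

  \<comment> \<open>The lift to unitary frames of the Gauss map along \<open>l\<close>.\<close>
  define u where "u t = (f (l t), \<chi> i. E i (l t))" for t
  have u': "(u has_vector_derivative (D y w, \<chi> i. E' i w)) (at 0)"
    using along[OF has_derivative_Pair[OF D_derivative[OF y] has_derivative_vec_lambda[OF E']]]
    by (simp add: u_def[abs_def])
  have u_ev: "\<forall>\<^sub>F t in nhds 0. u t \<in> unitary_frames J g c \<and> frame_proj (u t) = gauss_map d c (l t)"
  proof -
    have "\<forall>\<^sub>F t in nhds 0. l t \<in> overlap d c \<and> (\<forall>i j. induced (l t) (p i (l t)) (p j (l t)) = (if i = j then 1 else 0))"
      using p_ev l_lim by (rule eventually_compose_filterlim)
    then show ?thesis
    proof eventually_elim
      case (elim t)
      then show ?case
        using frame_span[of "l t" "\<lambda>i. p i (l t)"] f_in[of "l t"]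
        by (simp add: u_def E_def unitary_frames_def frame_proj_def gauss_map_def tangent_space_def tangent
            induced_def lagrangian_D' flip: f_def)
    qed
  qed

  have "maslov_form g gamma_bar d c y w = 2 * gamma_bar c (q y) (frechet_derivative q (at y) w)"
    by (simp add: maslov_form_def q_def[abs_def] blinfun.bilinear_simps)
  also have "gamma_bar c (q y) (frechet_derivative q (at y) w)
    = eval_on_curve (gamma_bar c) (\<lambda>v. lag_embed g c (frame_proj v)) u"
  proof -
    have ev: "\<forall>\<^sub>F t in nhds 0. lag_embed g c (frame_proj (u t)) = q (l t)"
      using u_ev by eventually_elim (simp add: q_def)
    \<comment> \<open>The projected frame curve agrees with the Gauss map along \<open>l\<close>
      near 0, so both have the same velocity.\<close>
    have "((\<lambda>t. lag_embed g c (frame_proj (u t))) has_vector_derivative frechet_derivative q (at y) w) (at 0)"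
      using along[OF q'] has_vector_derivative_cong_ev[where f = "\<lambda>t. lag_embed g c (frame_proj (u t))" and g = "\<lambda>t. q (l t)" and x = 0]
        ev eventually_nhds_x_imp_x[OF ev] by simp
    then show ?thesis
      using eventually_nhds_x_imp_x[OF ev] by (simp add: eval_on_curve_def vector_derivative_at l0)
  qed
  also have "\<dots> = Re (gamma_form J can c (u 0) (vector_derivative u (at 0)))"
  proof -
    have "u differentiable at 0" using u' by (rule differentiableI_vector)
    moreover have "\<forall>\<^sub>F t in nhds 0. u t \<in> unitary_frames J g c"
      using u_ev by eventually_elim simp
    ultimately show ?thesis
      using assms(6) c unfolding pulls_back_to_gamma_def by (metis Re_complex_of_real)
  qed
  also have "\<dots> = Re (gamma_form J can c (f y, \<chi> i. E i y) (D y w, \<chi> i. E' i w))"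
    by (simp add: vector_derivative_at[OF u'] u_def l0)
  also have "\<dots> = (\<Sum>j\<in>UNIV. g c (f y) (E' j w + can c (f y) (D y w) (E j y)) (J c (f y) (E j y)))"
    using Re_gamma_form[of g c "f y" J "\<chi> i. E i y", OF hermitian[OF f_in[OF y]] _ assms(2)]
      frame_unitary[OF y p] by (simp add: E_def)
  \<comment> \<open>Here the canonical symbols are exchanged for the Levi-Civita ones, term by term
    in the trace.\<close>
  also have "\<dots> = (\<Sum>k\<in>UNIV. cubic y (p k y) (p k y) w)"
    unfolding E_def E'_def
    by (rule frame_connection_trace[OF y]) (rule canonical_connection_trace[OF assms(3,4) c f_in[OF y]])
  finally show "- 2 * L_omega J g d c (mean_curvature g LC d c) y w = maslov_form g gamma_bar d c y w"
    using \<open>L_omega J g d c (mean_curvature g LC d c) y w = _\<close> by simp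
qed

end
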